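(* Let $d\in\{2,3\}$, let $c_0,c_1,\Omega,\gamma\in\mathbb{R}$, and let the real-valued trapping potential $V$ be radially symmetric, i.e. $V(\mathbf{x})=V(|\mathbf{x}|)$. Suppose that $\Phi_{\rm g}\in\mathcal{M}$ is a ground state, i.e. $\mathcal{E}(\Phi_{\rm g})=\min_{\Phi\in\mathcal{M}}\mathcal{E}(\Phi)$. Then $$\mathcal{E}_{\rm soc}(\Phi_{\rm g})\le 0.$$ Furthermore, for $\theta\in(0,2\pi)$ let $\Phi^\theta(\mathbf{x})=\Phi_{\rm g}(\mathcal{R}(\theta)\mathbf{x})$, where $$\mathcal{R}(\theta)=\begin{pmatrix}\cos\theta&-\sin\theta\\ \sin\theta&\cos\theta\end{pmatrix}\ (d=2),\qquad \mathcal{R}(\theta)=\begin{pmatrix}\cos\theta&-\sin\theta&0\\ \sin\theta&\cos\theta&0\\0&0&1\end{pmatrix}\ (d=3).$$ If $\mathcal{E}_{\rm soc}(\Phi_{\rm g})=0$, then $\Phi^\theta$ is also a ground state for every $\theta\in(0,2\pi)$. If $\mathcal{E}_{\rm soc}(\Phi_{\rm g})<0$, then $\Phi^\theta$ is not a ground state for any $\theta\in(0,2\pi)$.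
   Context: Points of $\mathbb{R}^d$ are written $\mathbf{x}=(x,y)$ if $d=2$ and $\mathbf{x}=(x,y,z)$ if $d=3$. All wave functions are complex valued. Let $L^2_V(\mathbb{R}^d)=\{\phi : \int_{\mathbb{R}^d}V(\mathbf{x})|\phi(\mathbf{x})|^2\,d\mathbf{x}<\infty\}$. The admissible set is $$\mathcal{M}=\Big\{\Phi=(\phi_1,\phi_0,\phi_{-1})^\top : \phi_j\in H^1(\mathbb{R}^d)\cap L^2_V(\mathbb{R}^d),\ j=-1,0,1,\ \int_{\mathbb{R}^d}\sum_{j=-1}^1|\phi_j|^2\,d\mathbf{x}=1,\ \Phi \text{ has finite energy}\Big\},$$ where finite energy means that all the integrals defining $\mathcal{E}(\Phi)$ below converge absolutely. The energy functional (rotating spin-orbit coupled spin-1 Bose-Einstein condensate) is $\mathcal{E}=\mathcal{E}_{\rm kin}+\mathcal{E}_{\rm pot}+\mathcal{E}_{\rm spin}+\mathcal{E}_{\rm rot}+\mathcal{E}_{\rm soc}$, where $$\mathcal{E}_{\rm kin}(\Phi)=\frac12\int_{\mathbb{R}^d}\sum_{\ell=-1}^1|\nabla\phi_\ell|^2\,d\mathbf{x},\qquad \mathcal{E}_{\rm pot}(\Phi)=\int_{\mathbb{R}^d}\sum_{\ell=-1}^1V|\phi_\ell|^2\,d\mathbf{x},$$ $$\mathcal{E}_{\rm spin}(\Phi)=\int_{\mathbb{R}^d}\Big(\frac{c_0}{2}\rho^2+\frac{c_1}{2}|\mathbf{F}|^2\Big)\,d\mathbf{x},\qquad \mathcal{E}_{\rm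 rot}(\Phi)=-\Omega\int_{\mathbb{R}^d}\sum_{\ell=-1}^1\bar\phi_\ell L_z\phi_\ell\,d\mathbf{x},$$ $$\mathcal{E}_{\rm soc}(\Phi)=-\gamma\int_{\mathbb{R}^d}\Phi^\dagger\mathbf{S}\Phi\,d\mathbf{x}.$$ Here - $L_z=-i(x\partial_y-y\partial_x)$; - $\rho=|\phi_1|^2+|\phi_0|^2+|\phi_{-1}|^2$; - $\mathbf{F}=(F_x,F_y,F_z)$ is the real vector with $F_x=\frac{1}{\sqrt2}[\bar\phi_1\phi_0+\bar\phi_0(\phi_1+\phi_{-1})+\bar\phi_{-1}\phi_0]$, $F_y=\frac{i}{\sqrt2}[-\bar\phi_1\phi_0+\bar\phi_0(\phi_1-\phi_{-1})+\bar\phi_{-1}\phi_0]$, $F_z=|\phi_1|^2-|\phi_{-1}|^2$; - $\Phi^\dagger\mathbf{S}\Phi=\bar\phi_1L_0\phi_0+\bar\phi_0(L_0\phi_{-1}+L_1\phi_1)+\bar\phi_{-1}L_1\phi_0$ with $L_0=i\partial_x+\partial_y$ and $L_1=i\partial_x-\partial_y$. The spin-orbit and rotation energies are real (they are the quadratic forms of symmetric operators; $L_0,L_1$ are formal adjoints of each other); if desired, read $\mathcal{E}_{\rm rot}$ as the real part of the displayed integral. A ground state is any minimizer of $\mathcal{E}$ over $\mathcal{M}$. *)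

theory Defs
  imports "HOL-Analysis.Analysis"
begin

text \<open>
  Points of \<open>\<real>\<^sup>d\<close> are elements of \<^typ>\<open>real ^ 'n\<close>, where the index type is a ring of \<open>d\<close> elements
  (for instance the numeral types \<^typ>\<open>2\<close> and \<^typ>\<open>3\<close>); \<open>x $ 1\<close> and \<open>x $ 2\<close> are the first two
  coordinates. In such a ring \<open>1 \<noteq> 2\<close>; for \<open>d = 3\<close> the remaining index is \<open>3 = 0\<close>.
\<close>


type_synonym 'n space = "real ^ 'n"


subsection \<open>Test functions, weak derivatives and \<open>H\<^sup>1\<close>\<close>

definition partial :: "'n \<Rightarrow> ('n::finite space \<Rightarrow> real) \<Rightarrow> 'n space \<Rightarrow> real" where
  "partial i f x = frechet_derivative f (at x) (axis i 1)"

primrec C_k :: "nat \<Rightarrow> ('n::finite space \<Rightarrow> real) \<Rightarrow> bool" where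
  "C_k 0 f \<longleftrightarrow> continuous_on UNIV f"
| "C_k (Suc k) f \<longleftrightarrow> (\<forall>x. f differentiable (at x)) \<and> (\<forall>i. C_k k (partial i f))"

definition test_function :: "('n::finite space \<Rightarrow> real) \<Rightarrow> bool" where
  "test_function \<psi> \<longleftrightarrow> (\<forall>k. C_k k \<psi>) \<and> compact (closure {x. \<psi> x \<noteq> 0})"

definition L2 :: "('n::finite space \<Rightarrow> complex) set" where
  "L2 = {f. f \<in> borel_measurable lebesgue \<and> integrable lebesgue (\<lambda>x. (cmod (f x))\<^sup>2)}"

text \<open>The next predicate is only used for \<open>f\<close> and \<open>g\<close> in \<^const>\<open>L2\<close>, so that both integrals exist.\<close>

definition has_weak_partial ::
    "'n \<Rightarrow> ('n::finite space \<Rightarrow> complex) \<Rightarrow> ('n space \<Rightarrow> complex) \<Rightarrow> bool" where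
  "has_weak_partial i f g \<longleftrightarrow>
     (\<forall>\<psi>. test_function \<psi> \<longrightarrow>
        (LINT x|lebesgue. f x * of_real (partial i \<psi> x)) = - (LINT x|lebesgue. g x * of_real (\<psi> x)))"

definition H1 :: "('n::finite space \<Rightarrow> complex) set" where
  "H1 = {f \<in> L2. \<forall>i. \<exists>g\<in>L2. has_weak_partial i f g}"

text \<open>For \<open>f\<close> in \<^const>\<open>H1\<close> the weak derivative is determined up to a null set, which no integral
  below can see.\<close>

definition weak_partial :: "'n \<Rightarrow> ('n::finite space \<Rightarrow> complex) \<Rightarrow> 'n space \<Rightarrow> complex" where
  "weak_partial i f = (SOME g. g \<in> L2 \<and> has_weak_partial i f g)"

definition L2_weighted :: "('n::finite space \<Rightarrow> real) \<Rightarrow> ('n space \<Rightarrow> complex) set" where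
  "L2_weighted V = {f. integrable lebesgue (\<lambda>x. V x * (cmod (f x))\<^sup>2)}"


subsection \<open>The differential operators\<close>

definition Lz :: "('n::{finite,numeral} space \<Rightarrow> complex) \<Rightarrow> 'n space \<Rightarrow> complex" where
  "Lz f x = - \<i> * (of_real (x $ 1) * weak_partial 2 f x - of_real (x $ 2) * weak_partial 1 f x)"

definition L0 :: "('n::{finite,numeral} space \<Rightarrow> complex) \<Rightarrow> 'n space \<Rightarrow> complex" where
  "L0 f x = \<i> * weak_partial 1 f x + weak_partial 2 f x"

definition L1 :: "('n::{finite,numeral} space \<Rightarrow> complex) \<Rightarrow> 'n space \<Rightarrow> complex" where
  "L1 f x = \<i> * weak_partial 1 f x - weak_partial 2 f x"


subsection \<open>Spinors and their energy\<close>

text \<open>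
  The components of a spinor \<open>\<Phi> = (\<phi>\<^sub>1, \<phi>\<^sub>0, \<phi>\<^sub>-\<^sub>1)\<close> are indexed by the three elements
  \<open>1, 0, -1\<close> of the type \<^typ>\<open>3\<close>.
\<close>

lemma UNIV_spin: "(UNIV :: 3 set) = {-1, 0, 1}"
proof -
  have "card {-1, 0, 1 :: 3} = CARD(3)"
    by simp
  then show ?thesis
    by (metis card_subset_eq finite_class.finite_UNIV subset_UNIV)
qed

type_synonym 'n spinor = "'n space \<Rightarrow> complex ^ 3"

definition cpt :: "'n::finite spinor \<Rightarrow> 3 \<Rightarrow> 'n space \<Rightarrow> complex" where
  "cpt \<Phi> l x = \<Phi> x $ l"

definition rho :: "'n::finite spinor \<Rightarrow> 'n space \<Rightarrow> real" where
  "rho \<Phi> x = (cmod (cpt \<Phi> 1 x))\<^sup>2 + (cmod (cpt \<Phi> 0 x))\<^sup>2 + (cmod (cpt \<Phi> (-1) x))\<^sup>2"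

definition Fx :: "'n::finite spinor \<Rightarrow> 'n space \<Rightarrow> complex" where
  "Fx \<Phi> x = 1 / of_real (sqrt 2) *
     (cnj (cpt \<Phi> 1 x) * cpt \<Phi> 0 x + cnj (cpt \<Phi> 0 x) * (cpt \<Phi> 1 x + cpt \<Phi> (-1) x)
      + cnj (cpt \<Phi> (-1) x) * cpt \<Phi> 0 x)"

definition Fy :: "'n::finite spinor \<Rightarrow> 'n space \<Rightarrow> complex" where
  "Fy \<Phi> x = \<i> / of_real (sqrt 2) *
     (- cnj (cpt \<Phi> 1 x) * cpt \<Phi> 0 x + cnj (cpt \<Phi> 0 x) * (cpt \<Phi> 1 x - cpt \<Phi> (-1) x)
      + cnj (cpt \<Phi> (-1) x) * cpt \<Phi> 0 x)"

definition Fz :: "'n::finite spinor \<Rightarrow> 'n space \<Rightarrow> real" where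
  "Fz \<Phi> x = (cmod (cpt \<Phi> 1 x))\<^sup>2 - (cmod (cpt \<Phi> (-1) x))\<^sup>2"

text \<open>\<^const>\<open>Fx\<close> and \<^const>\<open>Fy\<close> are real, so taking real parts in the spin vector loses nothing.\<close>

lemma Fx_real: "Fx \<Phi> x \<in> \<real>" and Fy_real: "Fy \<Phi> x \<in> \<real>"
  by (auto simp: complex_is_Real_iff Fx_def Fy_def Im_divide_of_real algebra_simps diff_divide_distrib)

definition spin_vector :: "'n::finite spinor \<Rightarrow> 'n space \<Rightarrow> real ^ 3" where
  "spin_vector \<Phi> x = vector [Re (Fx \<Phi> x), Re (Fy \<Phi> x), Fz \<Phi> x]"

definition kin_density :: "'n::finite spinor \<Rightarrow> 'n space \<Rightarrow> real" where
  "kin_density \<Phi> x = (\<Sum>l\<in>{-1, 0, 1}. \<Sum>i\<in>UNIV. (cmod (weak_partial i (cpt \<Phi> l) x))\<^sup>2)"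

definition pot_density :: "('n space \<Rightarrow> real) \<Rightarrow> 'n::finite spinor \<Rightarrow> 'n space \<Rightarrow> real" where
  "pot_density V \<Phi> x = (\<Sum>l\<in>{-1, 0, 1}. V x * (cmod (cpt \<Phi> l x))\<^sup>2)"

definition spin_density :: "real \<Rightarrow> real \<Rightarrow> 'n::finite spinor \<Rightarrow> 'n space \<Rightarrow> real" where
  "spin_density c0 c1 \<Phi> x = c0 / 2 * (rho \<Phi> x)\<^sup>2 + c1 / 2 * (norm (spin_vector \<Phi> x))\<^sup>2"

definition rot_density :: "'n::{finite,numeral} spinor \<Rightarrow> 'n space \<Rightarrow> complex" where
  "rot_density \<Phi> x = (\<Sum>l\<in>{-1, 0, 1}. cnj (cpt \<Phi> l x) * Lz (cpt \<Phi> l) x)"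

definition soc_density :: "'n::{finite,numeral} spinor \<Rightarrow> 'n space \<Rightarrow> complex" where
  "soc_density \<Phi> x =
     cnj (cpt \<Phi> 1 x) * L0 (cpt \<Phi> 0) x
     + cnj (cpt \<Phi> 0 x) * (L0 (cpt \<Phi> (-1)) x + L1 (cpt \<Phi> 1) x)
     + cnj (cpt \<Phi> (-1) x) * L1 (cpt \<Phi> 0) x"

definition E_kin :: "'n::finite spinor \<Rightarrow> real" where
  "E_kin \<Phi> = 1 / 2 * (LINT x|lebesgue. kin_density \<Phi> x)"

definition E_pot :: "('n space \<Rightarrow> real) \<Rightarrow> 'n::finite spinor \<Rightarrow> real" where
  "E_pot V \<Phi> = (LINT x|lebesgue. pot_density V \<Phi> x)"

definition E_spin :: "real \<Rightarrow> real \<Rightarrow> 'n::finite spinor \<Rightarrow> real" where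
  "E_spin c0 c1 \<Phi> = (LINT x|lebesgue. spin_density c0 c1 \<Phi> x)"

text \<open>The rotation and spin-orbit integrals are quadratic forms of symmetric operators; their real
  part is taken to obtain energies of type \<^typ>\<open>real\<close>.\<close>

definition E_rot :: "real \<Rightarrow> 'n::{finite,numeral} spinor \<Rightarrow> real" where
  "E_rot \<Omega> \<Phi> = - \<Omega> * Re (LINT x|lebesgue. rot_density \<Phi> x)"

definition E_soc :: "real \<Rightarrow> 'n::{finite,numeral} spinor \<Rightarrow> real" where
  "E_soc \<gamma> \<Phi> = - \<gamma> * Re (LINT x|lebesgue. soc_density \<Phi> x)"

definition energy ::
    "('n space \<Rightarrow> real) \<Rightarrow> real \<Rightarrow> real \<Rightarrow> real \<Rightarrow> real \<Rightarrow> 'n::{finite,numeral} spinor \<Rightarrow> real" where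
  "energy V c0 c1 \<Omega> \<gamma> \<Phi> = E_kin \<Phi> + E_pot V \<Phi> + E_spin c0 c1 \<Phi> + E_rot \<Omega> \<Phi> + E_soc \<gamma> \<Phi>"

text \<open>Integrability in the sense of \<^const>\<open>integrable\<close> is absolute convergence.\<close>

definition finite_energy ::
    "('n space \<Rightarrow> real) \<Rightarrow> real \<Rightarrow> real \<Rightarrow> 'n::{finite,numeral} spinor \<Rightarrow> bool" where
  "finite_energy V c0 c1 \<Phi> \<longleftrightarrow>
     integrable lebesgue (kin_density \<Phi>) \<and>
     integrable lebesgue (pot_density V \<Phi>) \<and>
     integrable lebesgue (spin_density c0 c1 \<Phi>) \<and>
     integrable lebesgue (rot_density \<Phi>) \<and>
     integrable lebesgue (soc_density \<Phi>)"

definition admissible ::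
    "('n space \<Rightarrow> real) \<Rightarrow> real \<Rightarrow> real \<Rightarrow> 'n::{finite,numeral} spinor set" where
  "admissible V c0 c1 =
     {\<Phi>. (\<forall>l\<in>{-1, 0, 1}. cpt \<Phi> l \<in> H1 \<inter> L2_weighted V) \<and>
         (LINT x|lebesgue. (\<Sum>l\<in>{-1, 0, 1}. (cmod (cpt \<Phi> l x))\<^sup>2)) = 1 \<and>
         finite_energy V c0 c1 \<Phi>}"

definition ground_state ::
    "('n space \<Rightarrow> real) \<Rightarrow> real \<Rightarrow> real \<Rightarrow> real \<Rightarrow> real \<Rightarrow> 'n::{finite,numeral} spinor \<Rightarrow> bool" where
  "ground_state V c0 c1 \<Omega> \<gamma> \<Phi> \<longleftrightarrow>
     \<Phi> \<in> admissible V c0 c1 \<and>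
     (\<forall>\<Psi>\<in>admissible V c0 c1. energy V c0 c1 \<Omega> \<gamma> \<Phi> \<le> energy V c0 c1 \<Omega> \<gamma> \<Psi>)"


subsection \<open>Radial symmetry and rotations\<close>

definition radially_symmetric :: "('n::finite space \<Rightarrow> real) \<Rightarrow> bool" where
  "radially_symmetric V \<longleftrightarrow> (\<exists>v :: real \<Rightarrow> real. \<forall>x. V x = v (norm x))"

definition rotation :: "real \<Rightarrow> real ^ 'n::{finite,numeral} ^ 'n::{finite,numeral}" where
  "rotation \<theta> = (\<chi> i j.
     if i = 1 \<and> j = 1 then cos \<theta> else if i = 1 \<and> j = 2 then - sin \<theta>
     else if i = 2 \<and> j = 1 then sin \<theta> else if i = 2 \<and> j = 2 then cos \<theta>
     else if i = j then 1 else 0)"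

lemma rotation_2:
  "rotation \<theta> = (vector [vector [cos \<theta>, - sin \<theta>], vector [sin \<theta>, cos \<theta>]] :: real ^ 2 ^ 2)"
  by (simp add: vec_eq_iff forall_2 rotation_def)

lemma rotation_3:
  "rotation \<theta> = (vector [vector [cos \<theta>, - sin \<theta>, 0], vector [sin \<theta>, cos \<theta>, 0], vector [0, 0, 1]]
     :: real ^ 3 ^ 3)"
  by (simp add: vec_eq_iff forall_3 rotation_def)

end

theory Submission
  imports Defs "HOL-Computational_Algebra.Polynomial"
begin

text \<open>
  The idea is to let rotations of space and rotations of spin act independently. For angles
  \<open>\<alpha>\<close> and \<open>\<theta>\<close> let \<open>\<Psi>(x) = diag(cis \<alpha>, 1, cis (-\<alpha>)) \<Phi>(R(\<theta>) x)\<close>. All parts of the energy other than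
  the spin-orbit one are invariant under this action. In the spin-orbit density,
  \<open>L\<^sub>0(\<phi> \<circ> R(\<theta>)) = cis \<theta> (L\<^sub>0 \<phi>) \<circ> R(\<theta>)\<close> and \<open>L\<^sub>1(\<phi> \<circ> R(\<theta>)) = cis (-\<theta>) (L\<^sub>1 \<phi>) \<circ> R(\<theta>)\<close>, so that the
  terms with \<open>L\<^sub>0\<close> acquire the factor \<open>cis (\<theta> - \<alpha>)\<close> and those with \<open>L\<^sub>1\<close> its conjugate. With \<open>z\<close> the
  sum of the integral of the former and the conjugate of the integral of the latter, the
  spin-orbit energy of \<open>\<Psi>\<close> is \<open>- \<gamma> Re (cis (\<theta> - \<alpha>) z)\<close> (lemmas \<open>E_soc_eq\<close>, \<open>soc_amplitude_twist\<close>
  and \<open>energy_twist\<close>). No integration by parts is needed, because only real parts enter.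

  If \<open>\<Phi>\<close> is a ground state, minimality against all pure spin rotations (\<open>\<theta> = 0\<close>) says
  \<open>Re (cis \<beta> \<gamma> z) \<le> Re (\<gamma> z)\<close> for every \<open>\<beta>\<close>, that is, \<open>\<gamma> z\<close> is real and nonnegative
  (\<open>ground_state_soc_amplitude\<close>). Hence \<open>E\<^sub>s\<^sub>o\<^sub>c(\<Phi>) = - \<gamma> z \<le> 0\<close>, and the pure space rotation \<open>\<Phi> \<circ> R(\<theta>)\<close> has
  energy \<open>\<E>(\<Phi>) + (cos \<theta> - 1) E\<^sub>s\<^sub>o\<^sub>c(\<Phi>)\<close>, from which both alternatives can be read off.

  The analytic work lies in justifying the transformation of weak derivatives, which are chosen
  only up to null sets. Their uniqueness is the fundamental lemma of the calculus of variations,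
  proved here with explicit smooth cut-off functions of boxes; the change of variables rests on
  the invariance of Lebesgue measure under orthogonal maps, proved with the Vitali covering
  theorem.
\<close>

section \<open>Functions of class \<open>C\<^sup>k\<close>\<close>

lemma partial_eqI:
  assumes "(f has_derivative D) (at x)"
  shows "partial i f x = D (axis i 1)"
  unfolding partial_def using frechet_derivative_at[OF assms] by simp

lemma C_k_SucI:
  assumes "\<And>x. (f has_derivative D x) (at x)"
    and "\<And>i. C_k k (\<lambda>x. D x (axis i 1))"
  shows "C_k (Suc k) f"
proof -
  have "partial i f = (\<lambda>x. D x (axis i 1))" for i
    using partial_eqI[OF assms(1)] by blast
  then show ?thesis
    using assms by (auto simp: differentiable_def)
qed

lemma C_k_Suc_has_derivative:
  assumes "C_k (Suc k) f"
  shows "(f has_derivative frechet_derivative f (at x)) (at x)"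
  using assms by (simp add: frechet_derivative_works)

lemma C_k_Suc_imp_C_k: "C_k (Suc k) f \<Longrightarrow> C_k k f"
proof (induction k arbitrary: f)
  case 0
  then show ?case
    by (auto intro!: continuous_at_imp_continuous_on differentiable_imp_continuous_within)
next
  case (Suc k)
  then show ?case by auto
qed

lemma C_k_continuous: "C_k k f \<Longrightarrow> continuous_on UNIV f"
proof (induction k)
  case (Suc k)
  then show ?case using C_k_Suc_imp_C_k by blast
qed simp

lemma C_k_const: "C_k k (\<lambda>x. c)"
proof (induction k arbitrary: c)
  case (Suc k)
  show ?case
    by (rule C_k_SucI[where D = "\<lambda>x h. 0"]) (use Suc in auto)
qed simp

lemma C_k_add: "C_k k f \<Longrightarrow> C_k k g \<Longrightarrow> C_k k (\<lambda>x. f x + g x)"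
proof (induction k arbitrary: f g)
  case 0
  then show ?case by (auto intro: continuous_intros)
next
  case (Suc k)
  show ?case
  proof (rule C_k_SucI)
    show "((\<lambda>x. f x + g x) has_derivative
        (\<lambda>h. frechet_derivative f (at x) h + frechet_derivative g (at x) h)) (at x)" for x
      by (intro has_derivative_add C_k_Suc_has_derivative[OF Suc.prems(1)]
          C_k_Suc_has_derivative[OF Suc.prems(2)])
    show "C_k k (\<lambda>x. frechet_derivative f (at x) (axis i 1)
        + frechet_derivative g (at x) (axis i 1))" for i
      using Suc.prems Suc.IH[of "partial i f" "partial i g"] by (simp add: partial_def[abs_def])
  qed
qed

lemma C_k_mult: "C_k k f \<Longrightarrow> C_k k g \<Longrightarrow> C_k k (\<lambda>x. f x * g x)"
proof (induction k arbitrary: f g)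
  case 0
  then show ?case by (auto intro: continuous_intros)
next
  case (Suc k)
  show ?case
  proof (rule C_k_SucI)
    show "((\<lambda>x. f x * g x) has_derivative
        (\<lambda>h. f x * frechet_derivative g (at x) h + frechet_derivative f (at x) h * g x)) (at x)" for x
      by (intro has_derivative_mult C_k_Suc_has_derivative[OF Suc.prems(1)]
          C_k_Suc_has_derivative[OF Suc.prems(2)])
    show "C_k k (\<lambda>x. f x * frechet_derivative g (at x) (axis i 1)
        + frechet_derivative f (at x) (axis i 1) * g x)" for i
      using Suc.prems Suc.IH[of f "partial i g"] Suc.IH[of "partial i f" g]
        C_k_Suc_imp_C_k[OF Suc.prems(1)] C_k_Suc_imp_C_k[OF Suc.prems(2)]
      by (intro C_k_add) (auto simp: partial_def[abs_def])
  qed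
qed

lemma C_k_sum: "finite I \<Longrightarrow> (\<And>i. i \<in> I \<Longrightarrow> C_k k (f i)) \<Longrightarrow> C_k k (\<lambda>x. \<Sum>i\<in>I. f i x)"
  by (induction I rule: finite_induct) (auto intro: C_k_const C_k_add)

lemma C_k_prod: "finite I \<Longrightarrow> (\<And>i. i \<in> I \<Longrightarrow> C_k k (f i)) \<Longrightarrow> C_k k (\<lambda>x. \<Prod>i\<in>I. f i x)"
  by (induction I rule: finite_induct) (auto intro: C_k_const C_k_mult)

text \<open>
  A function of one coordinate is of class \<open>C\<^sup>k\<close> for all \<open>k\<close> as soon as it is the first term of a
  sequence in which every function is the derivative of its predecessor.
\<close>

lemma C_k_of_component:
  fixes F :: "nat \<Rightarrow> real \<Rightarrow> real"
  assumes "\<And>m t. (F m has_real_derivative F (Suc m) t) (at t)"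
  shows "C_k k (\<lambda>x. F m (x $ j))"
proof (induction k arbitrary: m)
  case 0
  have "continuous_on UNIV (F m)"
    using assms DERIV_isCont continuous_at_imp_continuous_on by blast
  then show ?case
    by (auto intro!: continuous_on_compose2[where f = "\<lambda>x. x $ j"] continuous_intros)
next
  case (Suc k)
  show ?case
  proof (rule C_k_SucI)
    show "((\<lambda>x. F m (x $ j)) has_derivative (\<lambda>h. h $ j * F (Suc m) (x $ j))) (at x)" for x
      by (rule has_derivative_compose[of "\<lambda>x. x $ j" "\<lambda>h. h $ j" x UNIV "F m" "\<lambda>h. h * F (Suc m) (x $ j)"])
        (use assms[of m "x $ j"] in \<open>auto simp: has_field_derivative_def mult.commute[of _ "F (Suc m) (x $ j)"]
          intro: bounded_linear_imp_has_derivative bounded_linear_vec_nth\<close>)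
    show "C_k k (\<lambda>x. axis i 1 $ j * F (Suc m) (x $ j))" for i
      by (intro C_k_mult C_k_const Suc.IH)
  qed
qed

lemma partial_matrix_compose:
  assumes "f differentiable (at (A *v x))"
  shows "partial i (\<lambda>x. f (A *v x)) x = (\<Sum>j\<in>UNIV. A $ j $ i * partial j f (A *v x))"
proof -
  let ?D = "frechet_derivative f (at (A *v x))"
  have D: "(f has_derivative ?D) (at (A *v x))"
    using assms by (simp add: frechet_derivative_works)
  have "linear ?D"
    using D has_derivative_linear by blast
  have "((\<lambda>x. f (A *v x)) has_derivative (\<lambda>h. ?D (A *v h))) (at x)"
    by (rule has_derivative_compose[of "(*v) A" "(*v) A" x UNIV f])
      (use D in \<open>auto intro: bounded_linear_imp_has_derivative matrix_vector_mul_bounded_linear\<close>)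
  then have "partial i (\<lambda>x. f (A *v x)) x = ?D (A *v axis i 1)"
    by (rule partial_eqI)
  also have "A *v axis i 1 = (\<Sum>j\<in>UNIV. A $ j $ i *\<^sub>R axis j 1)"
    unfolding matrix_vector_mult_basis
    by (simp add: vec_eq_iff column_def axis_def if_distrib cong: if_cong)
  also have "?D \<dots> = (\<Sum>j\<in>UNIV. A $ j $ i * partial j f (A *v x))"
    using \<open>linear ?D\<close> by (simp add: linear_sum linear_cmul partial_def)
  finally show ?thesis .
qed

lemma C_k_matrix_compose: "C_k k f \<Longrightarrow> C_k k (\<lambda>x. f (A *v x))"
proof (induction k arbitrary: f)
  case 0
  then show ?case
    by (auto intro!: continuous_on_compose2[where f = "(*v) A"] matrix_vector_mult_linear_continuous_on)
next
  case (Suc k)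
  then have "partial i (\<lambda>x. f (A *v x)) = (\<lambda>x. \<Sum>j\<in>UNIV. A $ j $ i * partial j f (A *v x))" for i
    by (intro ext partial_matrix_compose) simp
  moreover have "(\<lambda>x. f (A *v x)) differentiable (at x)" for x
    using Suc.prems by (intro differentiable_compose[of f "(*v) A"])
      (simp_all add: linear_imp_differentiable)
  ultimately show ?case
    using Suc by (simp add: C_k_sum C_k_mult C_k_const)
qed

section \<open>Smooth cut-off functions of boxes\<close>

text \<open>
  The functions \<open>p(1/t) exp(-1/t)\<close> for \<open>t > 0\<close>, extended by \<open>0\<close>, with \<open>p\<close> a polynomial. This class is closed
  under differentiation, and \<open>p = 1\<close> gives the standard smooth function supported in a half-line.
\<close>

definition flat_exp :: "real poly \<Rightarrow> real \<Rightarrow> real" where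
  "flat_exp p t = (if t > 0 then poly p (1 / t) * exp (- (1 / t)) else 0)"

lemma poly_times_exp_minus_tendsto_0:
  "((\<lambda>s. poly p s * exp (- s)) \<longlongrightarrow> (0::real)) at_top"
proof -
  have "((\<lambda>s. \<Sum>i\<le>degree p. coeff p i * (s ^ i / exp s)) \<longlongrightarrow> (\<Sum>i\<le>degree p. coeff p i * 0)) at_top"
    by (intro tendsto_intros tendsto_power_div_exp_0)
  then show ?thesis
    by (simp add: poly_altdef sum_distrib_right exp_minus divide_inverse mult.assoc)
qed

text \<open>The derivative replaces \<open>p\<close> by \<open>X\<^sup>2 (p - p')\<close>.\<close>

lemma flat_exp_deriv:
  "(flat_exp p has_real_derivative flat_exp (pCons 0 (pCons 0 (p - pderiv p))) t) (at t)"
proof (cases t "0 :: real" rule: linorder_cases)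
  case less
  have "((\<lambda>t. 0) has_real_derivative 0) (at t)"
    by simp
  then have "(flat_exp p has_real_derivative 0) (at t)"
    by (rule DERIV_cong_ev[THEN iffD1, rotated -1])
      (use less in \<open>auto simp: flat_exp_def eventually_nhds intro!: exI[of _ "{..<0}"]\<close>)
  with less show ?thesis by (simp add: flat_exp_def)
next
  case greater
  have "((\<lambda>t. poly p (1 / t) * exp (- (1 / t))) has_real_derivative
      flat_exp (pCons 0 (pCons 0 (p - pderiv p))) t) (at t)"
    using greater
    by (auto intro!: derivative_eq_intros DERIV_chain2[OF poly_DERIV] simp: flat_exp_def field_simps power2_eq_square)
  then show ?thesis
    by (rule DERIV_cong_ev[THEN iffD1, rotated -1])
      (use greater in \<open>auto simp: flat_exp_def eventually_nhds intro!: exI[of _ "{0<..}"]\<close>)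
next
  case equal
  have "((\<lambda>h. flat_exp p h / h) \<longlongrightarrow> 0) (at_left 0)"
    by (rule tendsto_eventually) (auto simp: eventually_at_filter flat_exp_def)
  moreover have "((\<lambda>h. flat_exp p h / h) \<longlongrightarrow> 0) (at_right 0)"
  proof -
    have "((\<lambda>h. poly (pCons 0 p) (inverse h) * exp (- inverse h)) \<longlongrightarrow> 0) (at_right (0::real))"
      using filterlim_compose[OF poly_times_exp_minus_tendsto_0 filterlim_inverse_at_top_right] .
    then show ?thesis
      by (rule Lim_transform_eventually)
        (auto simp: eventually_at_filter flat_exp_def divide_inverse)
  qed
  ultimately have "((\<lambda>h. flat_exp p h / h) \<longlongrightarrow> 0) (at 0)"
    by (rule filterlim_split_at)
  then show ?thesis
    using equal by (simp add: DERIV_def) (simp add: flat_exp_def)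
qed

lemma flat_exp_affine_C_k: "C_k k (\<lambda>x. flat_exp p (a * (x $ j) + b))"
proof -
  define P where "P = rec_nat p (\<lambda>_ q. pCons 0 (pCons 0 (q - pderiv q)))"
  define F where "F m t = a ^ m * flat_exp (P m) (a * t + b)" for m t
  have "(F m has_real_derivative F (Suc m) t) (at t)" for m t
    unfolding F_def
    by (auto intro!: derivative_eq_intros DERIV_chain2[OF flat_exp_deriv] simp: P_def)
  from C_k_of_component[of F, OF this, where m = 0] show ?thesis
    by (simp add: F_def P_def)
qed

text \<open>
  A smooth function which is positive exactly on the open box with corners \<open>a\<close> and \<open>b\<close> (if \<open>m > 0\<close>).
  Since \<open>exp(-1/(m t))\<close> is the \<open>m\<close>-th root of \<open>exp(-1/t)\<close>, these functions tend to the indicator function of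
  the box as \<open>m\<close> grows.
\<close>

definition box_cutoff :: "real ^ 'n \<Rightarrow> real ^ 'n \<Rightarrow> nat \<Rightarrow> real ^ 'n \<Rightarrow> real" where
  "box_cutoff a b m x =
     (\<Prod>i\<in>UNIV. flat_exp 1 (real m * (x $ i - a $ i)) * flat_exp 1 (real m * (b $ i - x $ i)))"

lemma flat_exp_1_bounds: "0 \<le> flat_exp 1 t" "flat_exp 1 t \<le> 1"
  by (auto simp: flat_exp_def)

lemma box_cutoff_bounds: "0 \<le> box_cutoff a b m x" "box_cutoff a b m x \<le> 1"
  unfolding box_cutoff_def
  by (auto intro!: prod_nonneg prod_le_1 mult_nonneg_nonneg mult_le_one flat_exp_1_bounds)

lemma box_cutoff_outside: "x \<notin> box a b \<Longrightarrow> box_cutoff a b m x = 0"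
  unfolding box_cutoff_def mem_box_cart
  by (auto simp: flat_exp_def mult_less_0_iff zero_less_mult_iff intro!: prod_zero)

lemma test_function_box_cutoff: "test_function (box_cutoff a b m)"
proof -
  have "C_k k (\<lambda>x. flat_exp 1 (real m * (x $ i - a $ i)) * flat_exp 1 (real m * (b $ i - x $ i)))" for k i
    using C_k_mult[OF flat_exp_affine_C_k[of k 1 "real m" i "- real m * a $ i"]
        flat_exp_affine_C_k[of k 1 "- real m" i "real m * b $ i"]]
    by (simp add: algebra_simps)
  then have "C_k k (box_cutoff a b m)" for k
    unfolding box_cutoff_def[abs_def] by (intro C_k_prod) auto
  moreover have "{x. box_cutoff a b m x \<noteq> 0} \<subseteq> box a b"
    using box_cutoff_outside by blast
  then have "bounded {x. box_cutoff a b m x \<noteq> 0}"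
    using bounded_box bounded_subset by blast
  ultimately show ?thesis
    by (simp add: test_function_def compact_closure)
qed

lemma box_cutoff_tendsto: "(\<lambda>m. box_cutoff a b m x) \<longlonglongrightarrow> indicator (box a b) x"
proof (cases "x \<in> box a b")
  case True
  have *: "(\<lambda>m. flat_exp 1 (real m * s)) \<longlonglongrightarrow> 1" if "s > 0" for s
  proof -
    have "(\<lambda>m. exp (- (inverse s * inverse (real m)))) \<longlonglongrightarrow> exp (- (inverse s * 0))"
      by (intro tendsto_intros lim_inverse_n)
    then have "(\<lambda>m. exp (- (inverse s * inverse (real m)))) \<longlonglongrightarrow> 1"
      by simp
    then show ?thesis
      by (rule Lim_transform_eventually)
        (use that in \<open>auto simp: flat_exp_def eventually_sequentially field_simps intro!: exI[of _ 1]\<close>)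
  qed
  have "(\<lambda>m. box_cutoff a b m x) \<longlonglongrightarrow> (\<Prod>i\<in>(UNIV :: 'a set). 1 * 1)"
    unfolding box_cutoff_def
    using True by (intro tendsto_prod tendsto_mult *) (auto simp: mem_box_cart)
  with True show ?thesis by simp
qed (simp add: box_cutoff_outside)

section \<open>Square integrable functions\<close>

lemma L2_measurable [measurable_dest]: "f \<in> L2 \<Longrightarrow> f \<in> borel_measurable lebesgue"
  by (simp add: L2_def)

lemma L2_mult_integrable:
  assumes "f \<in> L2" "g \<in> L2"
  shows "integrable lebesgue (\<lambda>x. f x * g x)"
proof (rule Bochner_Integration.integrable_bound)
  show "integrable lebesgue (\<lambda>x. (cmod (f x))\<^sup>2 + (cmod (g x))\<^sup>2)"
    using assms by (simp add: L2_def)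
  show "(\<lambda>x. f x * g x) \<in> borel_measurable lebesgue"
    by (intro borel_measurable_times assms[THEN L2_measurable])
  have "norm (a * b) \<le> norm ((cmod a)\<^sup>2 + (cmod b)\<^sup>2)" for a b :: complex
  proof -
    have "0 \<le> cmod a * cmod b"
      by simp
    with sum_squares_bound[of "cmod a" "cmod b"] have "cmod a * cmod b \<le> (cmod a)\<^sup>2 + (cmod b)\<^sup>2"
      by linarith
    then show ?thesis
      by (simp add: norm_mult)
  qed
  then show "AE x in lebesgue. norm (f x * g x) \<le> norm ((cmod (f x))\<^sup>2 + (cmod (g x))\<^sup>2)"
    by simp
qed

lemma L2_cnj: "f \<in> L2 \<Longrightarrow> (\<lambda>x. cnj (f x)) \<in> L2"
  by (auto simp: L2_def intro!: borel_measurable_continuous_on[of cnj] continuous_intros)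

lemma L2_zero: "(\<lambda>x. 0) \<in> L2"
  by (simp add: L2_def)

lemma L2_cmult: "f \<in> L2 \<Longrightarrow> (\<lambda>x. c * f x) \<in> L2"
  by (simp add: L2_def norm_mult power_mult_distrib borel_measurable_times)

lemma L2_add:
  assumes "f \<in> L2" "g \<in> L2"
  shows "(\<lambda>x. f x + g x) \<in> L2"
proof -
  have "integrable lebesgue (\<lambda>x. (cmod (f x + g x))\<^sup>2)"
  proof (rule Bochner_Integration.integrable_bound)
    show "integrable lebesgue (\<lambda>x. 2 * ((cmod (f x))\<^sup>2 + (cmod (g x))\<^sup>2))"
      using assms by (simp add: L2_def)
    show "(\<lambda>x. (cmod (f x + g x))\<^sup>2) \<in> borel_measurable lebesgue"
      using assms[THEN L2_measurable] by measurable
    have "(cmod (a + b))\<^sup>2 \<le> 2 * ((cmod a)\<^sup>2 + (cmod b)\<^sup>2)" for a b :: complex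
    proof -
      have "(cmod (a + b))\<^sup>2 \<le> (cmod a + cmod b)\<^sup>2"
        by (intro power_mono norm_triangle_ineq) auto
      also have "\<dots> \<le> 2 * ((cmod a)\<^sup>2 + (cmod b)\<^sup>2)"
        using sum_squares_bound[of "cmod a" "cmod b"] by (simp add: power2_sum)
      finally show ?thesis .
    qed
    then show "AE x in lebesgue. norm ((cmod (f x + g x))\<^sup>2)
        \<le> norm (2 * ((cmod (f x))\<^sup>2 + (cmod (g x))\<^sup>2))"
      by simp
  qed
  with assms show ?thesis
    by (simp add: L2_def borel_measurable_add)
qed

lemma L2_sum: "finite I \<Longrightarrow> (\<And>i. i \<in> I \<Longrightarrow> f i \<in> L2) \<Longrightarrow> (\<lambda>x. \<Sum>i\<in>I. f i x) \<in> L2"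
  by (induction I rule: finite_induct) (auto intro: L2_zero L2_add)

lemma L2_diff: "f \<in> L2 \<Longrightarrow> g \<in> L2 \<Longrightarrow> (\<lambda>x. f x - g x) \<in> L2"
  using L2_add[of f "\<lambda>x. - 1 * g x"] L2_cmult[of g "- 1"] by simp

lemma L2_indicator_box: "(\<lambda>x. of_real (indicator (box a b) x)) \<in> L2"
proof -
  have "(cmod (of_real (indicator (box a b) x)))\<^sup>2 = indicator (box a b) x" for x
    by (auto simp: indicator_def)
  moreover have "box a b \<in> lmeasurable"
    by simp
  then have "integrable lebesgue (indicator (box a b) :: _ \<Rightarrow> real)"
    by (intro integrable_real_indicator) (auto simp: fmeasurable_def)
  moreover have "(\<lambda>x. complex_of_real (indicator (box a b) x)) \<in> borel_measurable lebesgue"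
    by (rule measurable_compose[OF borel_measurable_indicator borel_measurable_of_real])
      simp
  ultimately show ?thesis
    by (simp add: L2_def)
qed

lemma L2_continuous_compact_support:
  fixes \<psi> :: "'n::finite space \<Rightarrow> real"
  assumes "continuous_on UNIV \<psi>" and "compact K" and "\<And>x. x \<notin> K \<Longrightarrow> \<psi> x = 0"
  shows "(\<lambda>x. of_real (\<psi> x)) \<in> L2"
proof -
  have m: "\<psi> \<in> borel_measurable lebesgue"
    using assms(1) by (simp add: borel_measurable_continuous_onI measurable_completion)
  have "integrable lborel (\<lambda>x. indicator K x *\<^sub>R (\<psi> x)\<^sup>2)"
    by (intro borel_integrable_compact continuous_intros continuous_on_subset[OF assms(1)] assms(2))
      auto
  moreover have "indicator K x *\<^sub>R (\<psi> x)\<^sup>2 = (\<psi> x)\<^sup>2" for x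
    using assms(3) by (auto simp: indicator_def)
  ultimately have "integrable lborel (\<lambda>x. (\<psi> x)\<^sup>2)"
    by (simp only:)
  then have "integrable lebesgue (\<lambda>x. (\<psi> x)\<^sup>2)"
    by (subst integrable_completion) auto
  with m show ?thesis
    by (simp add: L2_def)
qed

lemma test_function_L2:
  assumes "test_function \<psi>"
  shows "(\<lambda>x. of_real (\<psi> x)) \<in> L2"
proof (rule L2_continuous_compact_support)
  show "continuous_on UNIV \<psi>" "compact (closure {x. \<psi> x \<noteq> 0})"
    using assms C_k_continuous by (auto simp: test_function_def)
  show "\<psi> x = 0" if "x \<notin> closure {x. \<psi> x \<noteq> 0}" for x
    using that closure_subset by force
qed

lemma test_function_partial_L2:
  assumes "test_function \<psi>"
  shows "(\<lambda>x. of_real (partial i \<psi> x)) \<in> L2"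
proof (rule L2_continuous_compact_support)
  let ?K = "closure {x. \<psi> x \<noteq> 0}"
  have "C_k (Suc 0) \<psi>"
    using assms unfolding test_function_def by blast
  then show "continuous_on UNIV (partial i \<psi>)"
    by simp
  show "compact ?K"
    using assms by (simp add: test_function_def)
  show "partial i \<psi> x = 0" if "x \<notin> ?K" for x
  proof -
    have "((\<lambda>x. 0) has_derivative (\<lambda>h. 0)) (at x)"
      by simp
    then have "(\<psi> has_derivative (\<lambda>h. 0)) (at x)"
    proof (rule has_derivative_transform_within_open)
      show "open (- ?K)" "x \<in> - ?K"
        using that by auto
      show "0 = \<psi> y" if "y \<in> - ?K" for y
        using that closure_subset by force
    qed
    then show ?thesis
      by (rule partial_eqI)
  qed
qed

section \<open>The fundamental lemma of the calculus of variations\<close>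

lemma sigma_finite_lebesgue: "sigma_finite_measure (lebesgue :: 'a::euclidean_space measure)"
proof
  obtain A :: "'a set set" where "countable A" "A \<subseteq> sets lborel" "\<Union>A = UNIV"
    "\<forall>a\<in>A. emeasure lborel a \<noteq> \<infinity>"
    using lborel.sigma_finite_countable by auto
  then show "\<exists>A :: 'a set set. countable A \<and> A \<subseteq> sets lebesgue \<and> \<Union>A = space lebesgue \<and>
      (\<forall>a\<in>A. emeasure lebesgue a \<noteq> (\<infinity> :: ennreal))"
    by (intro exI[of _ A]) (auto simp: emeasure_completion main_part subset_iff)
qed

text \<open>
  Boxes form a generator of the Borel sets that is closed under intersection, so the integral of
  \<open>h\<close> vanishes over every Borel set.
\<close>

lemma AE_eq_0_if_integral_boxes_eq_0:
  fixes h :: "'n::finite space \<Rightarrow> complex"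
  assumes h: "integrable lebesgue h"
    and box0: "\<And>a b. (LINT x:box a b|lebesgue. h x) = 0"
    and int0: "(LINT x|lebesgue. h x) = 0"
  shows "AE x in lebesgue. h x = 0"
proof (rule sigma_finite_measure.density_zero[OF sigma_finite_lebesgue h])
  have set_h: "set_integrable lebesgue A h" if "A \<in> sets lebesgue" for A
    using h that by (simp add: set_integrable_def integrable_mult_indicator)
  have borel0: "(LINT x:A|lebesgue. h x) = 0" if "A \<in> sets borel" for A
  proof -
    let ?G = "range (\<lambda>(a, b). box a b :: 'n space set)"
    have "Int_stable ?G"
      by (auto simp: Int_stable_def box_Int_box)
    moreover have "?G \<subseteq> Pow UNIV"
      by simp
    moreover have borel: "sigma_sets UNIV ?G = sets borel"
      by (simp add: borel_eq_box)
    then have "A \<in> sigma_sets UNIV ?G"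
      using that by simp
    ultimately show ?thesis
    proof (induction rule: sigma_sets_induct_disjoint)
      case (basic A)
      then show ?case using box0 by auto
    next
      case empty
      show ?case by (simp add: set_lebesgue_integral_def)
    next
      case (compl A)
      then have A: "A \<in> sets lebesgue"
        using borel by simp
      have "(LINT x:UNIV|lebesgue. h x) = (LINT x:A|lebesgue. h x) + (LINT x:UNIV - A|lebesgue. h x)"
        using set_integral_Un[of A "UNIV - A" lebesgue h] set_h[OF A]
          set_h[OF sets.compl_sets[OF A]]
        by simp
      then show ?case
        using compl int0 by (simp add: set_lebesgue_integral_def)
    next
      case (union B)
      then have B: "\<And>i. B i \<in> sets lebesgue"
        using borel by auto
      have "(LINT x:(\<Union>i. B i)|lebesgue. h x) = (\<Sum>i. (LINT x:(B i)|lebesgue. h x))"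
        using union(1) B set_h
        by (intro lebesgue_integral_countable_add) (auto simp: disjoint_family_on_def)
      with union show ?case
        by simp
    qed
  qed
  \<comment> \<open>A Lebesgue measurable set differs from a Borel set by a null set.\<close>
  fix A :: "'n space set"
  assume "A \<in> sets lebesgue"
  then obtain S N N' where S: "A = S \<union> N" "N \<subseteq> N'" "N' \<in> null_sets lborel" "S \<in> sets lborel"
    by (rule sets_completionE)
  have "AE x in lborel. x \<notin> N'"
    using S(3) AE_not_in by blast
  then have "AE x in lebesgue. x \<notin> N'"
    by (rule AE_completion)
  then have "(LINT x:A|lebesgue. h x) = (LINT x:S|lebesgue. h x)"
    using S \<open>A \<in> sets lebesgue\<close> h borel_measurable_integrable[OF h]
    unfolding set_lebesgue_integral_def
    by (intro integral_cong_AE borel_measurable_scaleR borel_measurable_indicator)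
      (auto simp: indicator_def)
  with borel0 S(4) show "(LINT x:A|lebesgue. h x) = 0"
    by simp
qed

lemma fundamental_lemma_calculus_of_variations:
  fixes g :: "'n::finite space \<Rightarrow> complex"
  assumes g: "g \<in> L2"
    and test: "\<And>\<psi>. test_function \<psi> \<Longrightarrow> (LINT x|lebesgue. g x * of_real (\<psi> x)) = 0"
  shows "AE x in lebesgue. g x = 0"
proof -
  have int: "integrable lebesgue (\<lambda>x. g x * of_real (indicator (box a b) x))" for a b
    by (rule L2_mult_integrable[OF g L2_indicator_box])
  have box0: "(LINT x|lebesgue. g x * of_real (indicator (box a b) x)) = 0" for a b
  proof -
    have "(\<lambda>m. LINT x|lebesgue. g x * of_real (box_cutoff a b m x))
        \<longlonglongrightarrow> (LINT x|lebesgue. g x * of_real (indicator (box a b) x))"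
    proof (rule integral_dominated_convergence)
      show "integrable lebesgue (\<lambda>x. norm (g x * of_real (indicator (box a b) x)))"
        using int by (rule integrable_norm)
      show "(\<lambda>x. g x * of_real (indicator (box a b) x)) \<in> borel_measurable lebesgue"
        using int by (rule borel_measurable_integrable)
      show "(\<lambda>x. g x * of_real (box_cutoff a b m x)) \<in> borel_measurable lebesgue" for m
        using L2_mult_integrable[OF g test_function_L2[OF test_function_box_cutoff]]
        by (rule borel_measurable_integrable)
      show "AE x in lebesgue. (\<lambda>m. g x * of_real (box_cutoff a b m x))
          \<longlonglongrightarrow> g x * of_real (indicator (box a b) x)"
        by (intro AE_I2 tendsto_intros box_cutoff_tendsto)
      have "norm (g x * of_real (box_cutoff a b m x))
          \<le> norm (g x * of_real (indicator (box a b) x))" for m x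
        using box_cutoff_bounds[of a b m x] box_cutoff_outside[of x a b m]
        by (cases "x \<in> box a b") (auto simp: norm_mult mult_left_le)
      then show "AE x in lebesgue. norm (g x * of_real (box_cutoff a b m x))
          \<le> norm (g x * of_real (indicator (box a b) x))" for m
        by simp
    qed
    then show ?thesis
      by (simp add: test[OF test_function_box_cutoff] LIMSEQ_const_iff)
  qed
  \<comment> \<open>As \<open>g\<close> need not be integrable on the whole space, it is first cut off to a box.\<close>
  have "AE x in lebesgue. g x * of_real (indicator (box a b) x) = 0" for a b
  proof (rule AE_eq_0_if_integral_boxes_eq_0)
    fix c d :: "'n space"
    obtain p q where pq: "box c d \<inter> box a b = box p q"
      using box_Int_box[of c d a b] by blast
    have "indicator (box c d) x *\<^sub>R (g x * of_real (indicator (box a b) x))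
        = g x * of_real (indicator (box p q) x)" for x
      unfolding pq[symmetric] by (simp add: indicator_def)
    then show "(LINT x:box c d|lebesgue. g x * of_real (indicator (box a b) x)) = 0"
      unfolding set_lebesgue_integral_def by (simp add: box0)
  qed (rule int box0)+
  then have "AE x in lebesgue. \<forall>m::nat. g x * of_real
      (indicator (box (- (real m *\<^sub>R One)) (real m *\<^sub>R One)) x) = 0"
    unfolding AE_all_countable by blast
  then show ?thesis
  proof eventually_elim
    case (elim x)
    have "x \<in> (\<Union>m::nat. box (- (real m *\<^sub>R One)) (real m *\<^sub>R One))"
      by (simp only: UN_box_eq_UNIV UNIV_I)
    then obtain m :: nat where "x \<in> box (- (real m *\<^sub>R One)) (real m *\<^sub>R One)"
      by blast
    with elim show ?case
      by (metis indicator_simps(1) mult.right_neutral of_real_1)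
  qed
qed

section \<open>Invariance of Lebesgue measure under orthogonal transformations\<close>

lemma orthogonal_transformation_continuous:
  fixes f :: "'a::euclidean_space \<Rightarrow> 'a"
  assumes "orthogonal_transformation f"
  shows "continuous_on S f"
  using orthogonal_transformation_linear[OF assms]
  by (simp add: linear_continuous_on linear_conv_bounded_linear)

text \<open>
  Up to a null set, an open set is a disjoint union of countably many balls, and an orthogonal
  map sends balls to balls of the same radius and null sets to null sets.
\<close>

lemma emeasure_orthogonal_image_open:
  fixes f :: "'a::euclidean_space \<Rightarrow> 'a"
  assumes f: "orthogonal_transformation f" and U: "open U"
  shows "emeasure lborel (f ` U) = emeasure lborel U"
proof -
  define K where "K = {(c :: 'a, r :: real). 0 < r \<and> ball c r \<subseteq> U}"
  have cover: "\<exists>i. i \<in> K \<and> x \<in> ball (fst i) (snd i) \<and> snd i < d" if "x \<in> U" "0 < d" for x d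
  proof -
    obtain e where "e > 0" "ball x e \<subseteq> U"
      using openE[OF U \<open>x \<in> U\<close>] by blast
    then have "(x, min e (d / 2)) \<in> K"
      using that by (auto simp: K_def)
    with \<open>e > 0\<close> that show ?thesis
      by (intro exI[of _ "(x, min e (d / 2))"]) auto
  qed
  obtain C where C: "countable C" "C \<subseteq> K"
    and disj: "pairwise (\<lambda>i j. disjnt (ball (fst i) (snd i)) (ball (fst j) (snd j))) C"
    and neg: "negligible (U - (\<Union>i\<in>C. ball (fst i) (snd i)))"
    by (rule Vitali_covering_theorem_balls[of U K fst snd, OF cover])
  define N where "N = U - (\<Union>i\<in>C. ball (fst i) (snd i))"
  have sum: "emeasure lborel (g ` U) = (\<integral>\<^sup>+i. emeasure lborel (ball (g (fst i)) (snd i)) \<partial>count_space C)"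
    if g: "orthogonal_transformation g" for g :: "'a \<Rightarrow> 'a"
  proof -
    have lin: "linear g" and inj: "inj g" and surj: "surj g"
      using g orthogonal_transformation_inj orthogonal_transformation_surj
        orthogonal_transformation_linear by blast+
    have "ball (fst i) (snd i) \<subseteq> U" if "i \<in> C" for i
    proof -
      have "i \<in> K"
        using that C(2) by blast
      then show ?thesis
        by (simp add: K_def case_prod_beta)
    qed
    then have U_eq: "U = (\<Union>i\<in>C. ball (fst i) (snd i)) \<union> N"
      unfolding N_def by blast
    have gU: "g ` U = (\<Union>i\<in>C. ball (g (fst i)) (snd i)) \<union> g ` N"
      using arg_cong[OF U_eq, of "image g"]
      by (simp only: image_UN image_Un image_orthogonal_transformation_ball[OF g])
    have "open (g ` U)"
      using U lin surj open_surjective_linear_image by blast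
    have gN: "g ` N = g ` U - (\<Union>i\<in>C. ball (g (fst i)) (snd i))"
      unfolding N_def image_set_diff[OF inj] image_UN
      using image_orthogonal_transformation_ball[OF g] by simp
    have gN_borel: "g ` N \<in> sets borel"
      unfolding gN using \<open>open (g ` U)\<close> C(1) by (intro sets.Diff sets.countable_UN') auto
    have "negligible (g ` N)"
      using neg lin unfolding N_def[symmetric]
      by (intro negligible_differentiable_image_negligible) (auto intro: linear_imp_differentiable_on)
    then have "g ` N \<in> null_sets lborel"
      using gN_borel by (simp add: negligible_iff_null_sets null_sets_completion_iff)
    then have "emeasure lborel (g ` U) = emeasure lborel (\<Union>i\<in>C. ball (g (fst i)) (snd i))"
      unfolding gU using C(1) by (intro emeasure_Un_null_set sets.countable_UN') auto
    also have "\<dots> = (\<integral>\<^sup>+i. emeasure lborel (ball (g (fst i)) (snd i)) \<partial>count_space C)"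
    proof (rule emeasure_UN_countable)
      have "disjnt (ball (g (fst i)) (snd i)) (ball (g (fst j)) (snd j))"
        if "i \<in> C" "j \<in> C" "i \<noteq> j" for i j
        using disj that inj unfolding image_orthogonal_transformation_ball[OF g, symmetric]
        by (simp add: pairwise_def disjnt_def image_Int[symmetric])
      then show "disjoint_family_on (\<lambda>i. ball (g (fst i)) (snd i)) C"
        by (simp add: disjoint_family_on_def disjnt_def)
    qed (use C(1) in auto)
    finally show ?thesis .
  qed
  have "emeasure lborel (ball (f (fst i)) (snd i)) = emeasure lborel (ball (fst i) (snd i))"
    if "i \<in> C" for i
    using that C(2) by (auto simp: K_def emeasure_ball)
  then have "emeasure lborel (f ` U) = emeasure lborel (id ` U)"
    unfolding sum[OF f] sum[OF orthogonal_transformation_id[unfolded id_def[symmetric]]]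
    by (intro nn_integral_cong) simp
  then show ?thesis
    by simp
qed

lemma lborel_distr_orthogonal:
  fixes f :: "'a::euclidean_space \<Rightarrow> 'a"
  assumes f: "orthogonal_transformation f"
  shows "distr lborel borel f = lborel"
proof (rule lborel_eqI[symmetric])
  have meas: "f \<in> borel_measurable borel"
    by (intro borel_measurable_continuous_onI orthogonal_transformation_continuous f)
  fix l u :: 'a
  assume lu: "\<And>b. b \<in> Basis \<Longrightarrow> l \<bullet> b \<le> u \<bullet> b"
  have "emeasure (distr lborel borel f) (box l u) = emeasure lborel (f -` box l u)"
    using meas by (simp add: emeasure_distr)
  also have "f -` box l u = inv f ` box l u"
    using orthogonal_transformation_bij[OF f] by (simp add: bij_vimage_eq_inv_image)
  also have "emeasure lborel \<dots> = emeasure lborel (box l u)"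
    using f by (intro emeasure_orthogonal_image_open orthogonal_transformation_inv open_box)
  finally show "emeasure (distr lborel borel f) (box l u) = (\<Prod>b\<in>Basis. (u - l) \<bullet> b)"
    using lu by simp
qed simp

lemma
  fixes f :: "'a::euclidean_space \<Rightarrow> 'a"
  assumes f: "orthogonal_transformation f"
  shows lebesgue_distr_orthogonal: "distr lebesgue lebesgue f = lebesgue"
    and lebesgue_measurable_orthogonal: "f \<in> lebesgue \<rightarrow>\<^sub>M lebesgue"
proof -
  have meas [measurable]: "f \<in> borel_measurable borel"
    by (intro borel_measurable_continuous_onI orthogonal_transformation_continuous f)
  have distr: "distr lebesgue lborel f = lborel"
    using lborel_distr_orthogonal[OF f] by (simp add: distr_completion cong: distr_cong)
  show "f \<in> lebesgue \<rightarrow>\<^sub>M lebesgue"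
    by (rule completion.measurable_completion2) (simp_all add: distr measurable_completion)
  have "distr lebesgue lebesgue f = completion (distr lebesgue lborel f)"
    by (rule completion.completion_distr_eq[symmetric]) (simp_all add: distr measurable_completion)
  then show "distr lebesgue lebesgue f = lebesgue"
    by (simp add: distr)
qed

lemma
  fixes f :: "'a::euclidean_space \<Rightarrow> 'a" and g :: "'a \<Rightarrow> 'b::{banach, second_countable_topology}"
  assumes f: "orthogonal_transformation f"
  shows integrable_orthogonal: "integrable lebesgue g \<Longrightarrow> integrable lebesgue (\<lambda>x. g (f x))"
    and integral_orthogonal:
      "g \<in> borel_measurable lebesgue \<Longrightarrow> (LINT x|lebesgue. g (f x)) = (LINT x|lebesgue. g x)"
proof -
  note m = lebesgue_measurable_orthogonal[OF f] and d = lebesgue_distr_orthogonal[OF f]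
  show "integrable lebesgue g \<Longrightarrow> integrable lebesgue (\<lambda>x. g (f x))"
    using integrable_distr[OF m, of g] by (simp add: d)
  show "g \<in> borel_measurable lebesgue \<Longrightarrow> (LINT x|lebesgue. g (f x)) = (LINT x|lebesgue. g x)"
    using integral_distr[OF m, of g] by (simp add: d)
qed

text \<open>
  The form in which the change of variables is applied to the energy densities, which transform
  only almost everywhere.
\<close>

lemma integrable_integral_AE_orthogonal:
  fixes f :: "'a::euclidean_space \<Rightarrow> 'a" and F G :: "'a \<Rightarrow> 'b::euclidean_space"
  assumes f: "orthogonal_transformation f" and F: "integrable lebesgue F"
    and AE: "AE x in lebesgue. G x = F (f x)"
  shows "integrable lebesgue G" and "(LINT x|lebesgue. G x) = (LINT x|lebesgue. F x)"
proof -
  have Ff: "integrable lebesgue (\<lambda>x. F (f x))"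
    by (rule integrable_orthogonal[OF f F])
  have AE': "AE x in lebesgue. F (f x) = G x"
    using AE by eventually_elim simp
  have G: "G \<in> borel_measurable lebesgue"
    by (rule borel_measurable_AE[OF borel_measurable_integrable[OF Ff] AE'])
  show "integrable lebesgue G"
    by (rule integrable_cong_AE_imp[OF Ff G AE'])
  have "(LINT x|lebesgue. G x) = (LINT x|lebesgue. F (f x))"
    by (rule integral_cong_AE[OF G borel_measurable_integrable[OF Ff] AE])
  also have "\<dots> = (LINT x|lebesgue. F x)"
    by (rule integral_orthogonal[OF f borel_measurable_integrable[OF F]])
  finally show "(LINT x|lebesgue. G x) = (LINT x|lebesgue. F x)" .
qed

lemma L2_orthogonal:
  fixes f :: "'n::finite space \<Rightarrow> 'n space"
  assumes f: "orthogonal_transformation f" and g: "g \<in> L2"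
  shows "(\<lambda>x. g (f x)) \<in> L2"
proof -
  have "integrable lebesgue (\<lambda>x. (cmod (g x))\<^sup>2)"
    using g by (simp add: L2_def)
  then have "integrable lebesgue (\<lambda>x. (cmod (g (f x)))\<^sup>2)"
    by (rule integrable_orthogonal[OF f])
  then show ?thesis
    using measurable_compose[OF lebesgue_measurable_orthogonal[OF f] L2_measurable[OF g]]
    by (simp add: L2_def)
qed

section \<open>Weak derivatives\<close>

lemma has_weak_partial_unique:
  fixes f :: "'n::finite space \<Rightarrow> complex"
  assumes "g \<in> L2" "h \<in> L2" "has_weak_partial i f g" "has_weak_partial i f h"
  shows "AE x in lebesgue. g x = h x"
proof -
  have "AE x in lebesgue. g x - h x = 0"
  proof (rule fundamental_lemma_calculus_of_variations)
    show "(\<lambda>x. g x - h x) \<in> L2"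
      using assms by (simp add: L2_diff)
    fix \<psi> :: "'n space \<Rightarrow> real" assume \<psi>: "test_function \<psi>"
    have int: "integrable lebesgue (\<lambda>x. k x * of_real (\<psi> x))" if "k \<in> L2" for k
      using L2_mult_integrable[OF that test_function_L2[OF \<psi>]] .
    have "(LINT x|lebesgue. f x * of_real (partial i \<psi> x)) = - (LINT x|lebesgue. g x * of_real (\<psi> x))"
      "(LINT x|lebesgue. f x * of_real (partial i \<psi> x)) = - (LINT x|lebesgue. h x * of_real (\<psi> x))"
      using assms(3,4) \<psi> unfolding has_weak_partial_def by blast+
    then have "(LINT x|lebesgue. g x * of_real (\<psi> x)) = (LINT x|lebesgue. h x * of_real (\<psi> x))"
      by simp
    then show "(LINT x|lebesgue. (g x - h x) * of_real (\<psi> x)) = 0"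
      using int assms(1,2) by (simp add: left_diff_distrib Bochner_Integration.integral_diff)
  qed
  then show ?thesis
    by simp
qed

lemma weak_partial_some:
  assumes "g \<in> L2" "has_weak_partial i f g"
  shows "weak_partial i f \<in> L2" and "has_weak_partial i f (weak_partial i f)"
proof -
  have "\<exists>g. g \<in> L2 \<and> has_weak_partial i f g"
    using assms by blast
  then have "weak_partial i f \<in> L2 \<and> has_weak_partial i f (weak_partial i f)"
    unfolding weak_partial_def by (rule someI_ex)
  then show "weak_partial i f \<in> L2" and "has_weak_partial i f (weak_partial i f)"
    by auto
qed

lemma weak_partial_H1:
  assumes "f \<in> H1"
  shows "weak_partial i f \<in> L2" and "has_weak_partial i f (weak_partial i f)"
proof -
  obtain g where "g \<in> L2" "has_weak_partial i f g"
    using assms by (auto simp: H1_def)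
  then show "weak_partial i f \<in> L2" and "has_weak_partial i f (weak_partial i f)"
    by (rule weak_partial_some)+
qed

lemma AE_weak_partial_eq:
  assumes "g \<in> L2" "has_weak_partial i f g"
  shows "AE x in lebesgue. weak_partial i f x = g x"
  by (rule has_weak_partial_unique[OF weak_partial_some(1)[OF assms] assms(1)
        weak_partial_some(2)[OF assms] assms(2)])

lemma has_weak_partial_cmult:
  assumes "has_weak_partial i f g"
  shows "has_weak_partial i (\<lambda>x. c * f x) (\<lambda>x. c * g x)"
  using assms by (simp add: has_weak_partial_def mult.assoc)

lemma test_function_matrix_compose:
  fixes A B :: "real ^ 'n ^ 'n"
  assumes \<psi>: "test_function \<psi>" and inv: "\<And>x. B *v (A *v x) = x"
  shows "test_function (\<lambda>x. \<psi> (A *v x))"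
proof -
  let ?K = "closure {x. \<psi> x \<noteq> 0}"
  have "{x. \<psi> (A *v x) \<noteq> 0} \<subseteq> (*v) B ` ?K"
  proof
    fix x assume "x \<in> {x. \<psi> (A *v x) \<noteq> 0}"
    then have "A *v x \<in> ?K"
      using closure_subset by force
    then show "x \<in> (*v) B ` ?K"
      using inv[of x] by (metis image_eqI)
  qed
  moreover have "compact ((*v) B ` ?K)"
    using \<psi> by (intro compact_continuous_image matrix_vector_mult_linear_continuous_on)
      (simp add: test_function_def)
  ultimately have "bounded {x. \<psi> (A *v x) \<noteq> 0}"
    using bounded_subset compact_imp_bounded by blast
  then show ?thesis
    using \<psi> C_k_matrix_compose by (auto simp: test_function_def compact_closure)
qed

text \<open>
  The chain rule for weak derivatives. The test function \<open>\<psi>\<close> is written as \<open>\<zeta> \<circ> R\<close>, and the classical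
  chain rule is applied to it.
\<close>

lemma has_weak_partial_orthogonal:
  fixes R :: "real ^ 'n ^ 'n" and f :: "'n space \<Rightarrow> complex"
  assumes R: "orthogonal_transformation ((*v) R)"
    and f: "f \<in> L2" and g: "\<And>j. g j \<in> L2" and fg: "\<And>j. has_weak_partial j f (g j)"
  shows "has_weak_partial i (\<lambda>x. f (R *v x)) (\<lambda>x. \<Sum>j\<in>UNIV. of_real (R $ j $ i) * g j (R *v x))"
  unfolding has_weak_partial_def
proof (intro allI impI)
  fix \<psi> :: "'n space \<Rightarrow> real" assume \<psi>: "test_function \<psi>"
  have "orthogonal_matrix R"
    using R by (simp add: orthogonal_transformation_matrix)
  then have RT: "R ** transpose R = mat 1" "transpose R ** R = mat 1"
    by (simp_all add: orthogonal_matrix_def)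
  define \<zeta> where "\<zeta> y = \<psi> (transpose R *v y)" for y
  have \<zeta>: "test_function \<zeta>"
    unfolding \<zeta>_def by (rule test_function_matrix_compose[OF \<psi>, of R])
      (simp only: matrix_vector_mul_assoc RT matrix_vector_mul_lid)
  have \<psi>_eq: "\<psi> = (\<lambda>x. \<zeta> (R *v x))"
    by (simp only: \<zeta>_def matrix_vector_mul_assoc RT matrix_vector_mul_lid)
  have "C_k (Suc 0) \<zeta>"
    using \<zeta> unfolding test_function_def by blast
  then have partial_\<psi>: "partial i \<psi> x = (\<Sum>j\<in>UNIV. R $ j $ i * partial j \<zeta> (R *v x))" for x
    unfolding \<psi>_eq by (intro partial_matrix_compose) simp
  have int_f: "integrable lebesgue (\<lambda>y. f y * of_real (partial j \<zeta> y))" for j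
    by (rule L2_mult_integrable[OF f test_function_partial_L2[OF \<zeta>]])
  have int_g: "integrable lebesgue (\<lambda>y. g j y * of_real (\<zeta> y))" for j
    by (rule L2_mult_integrable[OF g test_function_L2[OF \<zeta>]])
  let ?F = "\<lambda>y. \<Sum>j\<in>UNIV. of_real (R $ j $ i) * (f y * of_real (partial j \<zeta> y))"
  let ?G = "\<lambda>y. \<Sum>j\<in>UNIV. of_real (R $ j $ i) * (g j y * of_real (\<zeta> y))"
  have intF: "integrable lebesgue ?F" and intG: "integrable lebesgue ?G"
    using int_f int_g by (intro Bochner_Integration.integrable_sum integrable_mult_right; simp)+
  have "(LINT x|lebesgue. f (R *v x) * of_real (partial i \<psi> x)) = (LINT x|lebesgue. ?F (R *v x))"
    by (simp add: partial_\<psi> sum_distrib_left mult_ac)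
  also have "\<dots> = (LINT y|lebesgue. ?F y)"
    by (rule integral_orthogonal[OF R borel_measurable_integrable[OF intF]])
  also have "\<dots> = (\<Sum>j\<in>UNIV. of_real (R $ j $ i) * (LINT y|lebesgue. f y * of_real (partial j \<zeta> y)))"
    using int_f by (simp add: Bochner_Integration.integral_sum)
  also have "\<dots> = - (\<Sum>j\<in>UNIV. of_real (R $ j $ i) * (LINT y|lebesgue. g j y * of_real (\<zeta> y)))"
    using fg \<zeta> by (simp add: has_weak_partial_def sum_negf)
  also have "\<dots> = - (LINT y|lebesgue. ?G y)"
    using int_g by (simp add: Bochner_Integration.integral_sum)
  also have "\<dots> = - (LINT x|lebesgue. ?G (R *v x))"
    using integral_orthogonal[OF R borel_measurable_integrable[OF intG]] by simp
  also have "\<dots> = - (LINT x|lebesgue. (\<Sum>j\<in>UNIV. of_real (R $ j $ i) * g j (R *v x)) * of_real (\<psi> x))"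
    by (simp add: \<psi>_eq sum_distrib_right mult.assoc)
  finally show "(LINT x|lebesgue. f (R *v x) * of_real (partial i \<psi> x)) =
      - (LINT x|lebesgue. (\<Sum>j\<in>UNIV. of_real (R $ j $ i) * g j (R *v x)) * of_real (\<psi> x))" .
qed

lemma
  fixes R :: "real ^ 'n ^ 'n"
  assumes R: "orthogonal_transformation ((*v) R)" and f: "f \<in> H1"
  shows H1_cmult_orthogonal: "(\<lambda>x. c * f (R *v x)) \<in> H1"
    and AE_weak_partial_cmult_orthogonal: "AE x in lebesgue.
      weak_partial i (\<lambda>x. c * f (R *v x)) x
        = c * (\<Sum>j\<in>UNIV. of_real (R $ j $ i) * weak_partial j f (R *v x))"
proof -
  have fL2: "f \<in> L2"
    using f by (simp add: H1_def)
  let ?g = "\<lambda>i x. c * (\<Sum>j\<in>UNIV. of_real (R $ j $ i) * weak_partial j f (R *v x))"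
  have g: "?g i \<in> L2" for i
    by (intro L2_cmult L2_sum L2_orthogonal[OF R] weak_partial_H1 f) simp
  have d: "has_weak_partial i (\<lambda>x. c * f (R *v x)) (?g i)" for i
    by (intro has_weak_partial_cmult has_weak_partial_orthogonal R fL2 weak_partial_H1 f)
  show "AE x in lebesgue. weak_partial i (\<lambda>x. c * f (R *v x)) x = ?g i x"
    by (rule AE_weak_partial_eq[OF g d])
  show "(\<lambda>x. c * f (R *v x)) \<in> H1"
    using g d L2_cmult[OF L2_orthogonal[OF R fL2]] by (auto simp: H1_def)
qed

section \<open>Rotations\<close>

text \<open>
  The hypothesis \<open>1 \<noteq> 2\<close> on the index type says that the rotated coordinates are distinct.
\<close>

lemma sum_UNIV_12:
  fixes f :: "'n::{finite,numeral} \<Rightarrow> 'a::comm_monoid_add"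
  assumes "(1::'n) \<noteq> 2"
  shows "sum f UNIV = f 1 + f 2 + sum f (- {1, 2})"
proof -
  have "sum f UNIV = sum f {1, 2} + sum f (- {1, 2})"
    by (metis Compl_eq_Diff_UNIV add.commute finite finite_subset subset_UNIV sum.subset_diff)
  with assms show ?thesis
    by simp
qed

lemma sum_rotation_column:
  fixes c :: "'n::{finite,numeral} \<Rightarrow> complex"
  assumes "(1::'n) \<noteq> 2"
  shows "(\<Sum>j\<in>UNIV. of_real (rotation \<theta> $ j $ i) * c j) =
    (if i = 1 then of_real (cos \<theta>) * c 1 + of_real (sin \<theta>) * c 2
     else if i = 2 then - of_real (sin \<theta>) * c 1 + of_real (cos \<theta>) * c 2 else c i)"
proof (cases "i = 1 \<or> i = 2")
  case True
  then have "(\<Sum>j\<in>- {1, 2}. of_real (rotation \<theta> $ j $ i) * c j) = 0"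
    by (intro sum.neutral) (auto simp: rotation_def)
  with True assms show ?thesis
    by (auto simp: sum_UNIV_12 rotation_def)
next
  case False
  then have "of_real (rotation \<theta> $ j $ i) * c j = (if j = i then c i else 0)" for j
    by (auto simp: rotation_def)
  with False show ?thesis
    by simp
qed

lemma rotation_mult_component:
  fixes x :: "'n::{finite,numeral} space"
  assumes "(1::'n) \<noteq> 2"
  shows "(rotation \<theta> *v x) $ i =
    (if i = 1 then cos \<theta> * x $ 1 - sin \<theta> * x $ 2
     else if i = 2 then sin \<theta> * x $ 1 + cos \<theta> * x $ 2 else x $ i)"
proof (cases "i = 1 \<or> i = 2")
  case True
  then have "(\<Sum>j\<in>- {1, 2}. rotation \<theta> $ i $ j * x $ j) = 0"
    by (intro sum.neutral) (auto simp: rotation_def)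
  with True assms show ?thesis
    by (auto simp: matrix_vector_mult_def sum_UNIV_12 rotation_def)
next
  case False
  then have "rotation \<theta> $ i $ j * x $ j = (if j = i then x $ i else 0)" for j
    by (auto simp: rotation_def)
  with False show ?thesis
    by (simp add: matrix_vector_mult_def)
qed

lemma orthogonal_transformation_rotation:
  assumes "(1::'n::{finite,numeral}) \<noteq> 2"
  shows "orthogonal_transformation ((*v) (rotation \<theta> :: real ^ 'n::{finite,numeral} ^ 'n::{finite,numeral}))"
  unfolding orthogonal_transformation_def
proof (intro conjI allI)
  fix v w :: "'n space"
  let ?R = "rotation \<theta> :: real ^ 'n::{finite,numeral} ^ 'n::{finite,numeral}"
  have "(\<Sum>i\<in>- {1, 2}. (?R *v v) $ i * (?R *v w) $ i) = (\<Sum>i\<in>- {1, 2}. v $ i * w $ i)"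
    by (intro sum.cong) (auto simp: rotation_mult_component[OF assms])
  moreover have "(p * a - q * b) * (p * c - q * d) + (q * a + p * b) * (q * c + p * d)
      = (q\<^sup>2 + p\<^sup>2) * (a * c + b * d)" for p q a b c d :: real
    by algebra
  note this[of "cos \<theta>" _ "sin \<theta>"]
  ultimately show "(?R *v v) \<bullet> (?R *v w) = v \<bullet> w"
    using assms by (simp add: inner_vec_def sum_UNIV_12 rotation_mult_component[OF assms])
next
  show "linear ((*v) (rotation \<theta> :: real ^ 'n::{finite,numeral} ^ 'n::{finite,numeral}))"
    by (rule matrix_vector_mul_linear)
qed

section \<open>Simultaneous rotations of space and spin\<close>

text \<open>
  The entries of \<open>diag(cis \<alpha>, 1, cis (-\<alpha>))\<close>, the rotation of spin about the third axis.
\<close>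

definition spin_phase :: "real \<Rightarrow> 3 \<Rightarrow> complex" where
  "spin_phase \<alpha> l = (if l = 1 then cis \<alpha> else if l = 0 then 1 else cis (- \<alpha>))"

text \<open>
  The simultaneous rotation of spin by \<open>\<alpha>\<close> and of space by \<open>\<theta>\<close>.
\<close>

definition twist :: "real \<Rightarrow> real \<Rightarrow> 'n::{finite,numeral} spinor \<Rightarrow> 'n spinor" where
  "twist \<alpha> \<theta> \<Phi> x = (\<chi> l. spin_phase \<alpha> l * \<Phi> (rotation \<theta> *v x) $ l)"

text \<open>
  The terms of the spin-orbit density with \<open>L\<^sub>0\<close>.
\<close>

definition soc_up :: "'n::{finite,numeral} spinor \<Rightarrow> 'n space \<Rightarrow> complex" where
  "soc_up \<Phi> x = cnj (cpt \<Phi> 1 x) * L0 (cpt \<Phi> 0) x + cnj (cpt \<Phi> 0 x) * L0 (cpt \<Phi> (-1)) x"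

text \<open>
  The terms of the spin-orbit density with \<open>L\<^sub>1\<close>.
\<close>

definition soc_down :: "'n::{finite,numeral} spinor \<Rightarrow> 'n space \<Rightarrow> complex" where
  "soc_down \<Phi> x = cnj (cpt \<Phi> 0 x) * L1 (cpt \<Phi> 1) x + cnj (cpt \<Phi> (-1) x) * L1 (cpt \<Phi> 0) x"

text \<open>
  The complex number whose real part, times \<open>-\<gamma>\<close>, is the spin-orbit energy. The conjugate makes
  both summands transform by the same phase.
\<close>

definition soc_amplitude :: "'n::{finite,numeral} spinor \<Rightarrow> complex" where
  "soc_amplitude \<Phi> = (LINT x|lebesgue. soc_up \<Phi> x) + cnj (LINT x|lebesgue. soc_down \<Phi> x)"

lemma spin_phase_simps [simp]:
  "spin_phase \<alpha> 1 = cis \<alpha>" "spin_phase \<alpha> 0 = 1" "spin_phase \<alpha> (-1) = cis (- \<alpha>)"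
  by (simp_all add: spin_phase_def)

lemma cmod_spin_phase [simp]: "cmod (spin_phase \<alpha> l) = 1"
  by (simp add: spin_phase_def)

lemma cpt_twist: "cpt (twist \<alpha> \<theta> \<Phi>) l = (\<lambda>x. spin_phase \<alpha> l * cpt \<Phi> l (rotation \<theta> *v x))"
  by (simp add: cpt_def twist_def fun_eq_iff)

lemma twist_0: "twist 0 \<theta> \<Phi> = (\<lambda>x. \<Phi> (rotation \<theta> *v x))"
  by (simp add: twist_def vec_eq_iff spin_phase_def fun_eq_iff)

text \<open>
  \<open>F\<^sub>x\<close> and \<open>F\<^sub>y\<close> are \<open>\<surd>2\<close> times the real and imaginary parts of a single complex number, which a
  rotation of spin only multiplies by a phase.
\<close>

lemma norm_spin_vector_squared:
  "(norm (spin_vector \<Phi> x))\<^sup>2 =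
    2 * (cmod (cnj (cpt \<Phi> 1 x) * cpt \<Phi> 0 x + cnj (cpt \<Phi> 0 x) * cpt \<Phi> (-1) x))\<^sup>2 + (Fz \<Phi> x)\<^sup>2"
proof -
  let ?w = "cnj (cpt \<Phi> 1 x) * cpt \<Phi> 0 x + cnj (cpt \<Phi> 0 x) * cpt \<Phi> (-1) x"
  have "1 / sqrt 2 = sqrt 2 / (2 :: real)"
    by (simp add: field_simps)
  then have s: "1 / complex_of_real (sqrt 2) = of_real (sqrt 2 / 2)"
    by (metis of_real_1 of_real_divide)
  then have s': "\<i> / complex_of_real (sqrt 2) = \<i> * of_real (sqrt 2 / 2)"
    by (metis times_divide_eq_right mult.right_neutral)
  have x: "Fx \<Phi> x = of_real (sqrt 2 * Re ?w)"
    unfolding Fx_def s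
    by (simp add: complex_eq_iff algebra_simps add_divide_distrib diff_divide_distrib)
  have y: "Fy \<Phi> x = of_real (sqrt 2 * Im ?w)"
    unfolding Fy_def s'
    by (simp add: complex_eq_iff algebra_simps add_divide_distrib diff_divide_distrib)
  have "(norm (spin_vector \<Phi> x))\<^sup>2 = (Re (Fx \<Phi> x))\<^sup>2 + (Re (Fy \<Phi> x))\<^sup>2 + (Fz \<Phi> x)\<^sup>2"
    unfolding power2_norm_eq_inner
    by (simp add: inner_vec_def sum_3 spin_vector_def power2_eq_square)
  also have "\<dots> = 2 * (cmod ?w)\<^sup>2 + (Fz \<Phi> x)\<^sup>2"
    unfolding x y cmod_power2 by (simp only: Re_complex_of_real power_mult_distrib) simp
  finally show ?thesis .
qed

lemma soc_density_eq: "soc_density \<Phi> x = soc_up \<Phi> x + soc_down \<Phi> x"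
  by (simp add: soc_density_def soc_up_def soc_down_def algebra_simps)

subsection \<open>Pointwise transformation of the energy densities\<close>

lemma pot_density_twist:
  assumes "(1::'n::{finite,numeral}) \<noteq> 2"
    and "radially_symmetric (V :: 'n space \<Rightarrow> real)"
  shows "pot_density V (twist \<alpha> \<theta> \<Phi>) x = pot_density V \<Phi> (rotation \<theta> *v x)"
proof -
  have "V (rotation \<theta> *v x) = V x"
    using assms(2) orthogonal_transformation_norm[OF orthogonal_transformation_rotation[OF assms(1)]]
    unfolding radially_symmetric_def by metis
  then show ?thesis
    by (simp add: pot_density_def cpt_twist norm_mult)
qed

lemma spin_density_twist:
  "spin_density c0 c1 (twist \<alpha> \<theta> \<Phi>) x = spin_density c0 c1 \<Phi> (rotation \<theta> *v x)"
proof -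
  let ?w = "\<lambda>\<Phi> x. cnj (cpt \<Phi> 1 x) * cpt \<Phi> 0 x + cnj (cpt \<Phi> 0 x) * cpt \<Phi> (-1) x"
  have "?w (twist \<alpha> \<theta> \<Phi>) x = cis (- \<alpha>) * ?w \<Phi> (rotation \<theta> *v x)"
    by (simp add: cpt_twist cis_cnj algebra_simps)
  then have "cmod (?w (twist \<alpha> \<theta> \<Phi>) x) = cmod (?w \<Phi> (rotation \<theta> *v x))"
    by (simp only: norm_mult norm_cis mult_1)
  moreover have "Fz (twist \<alpha> \<theta> \<Phi>) x = Fz \<Phi> (rotation \<theta> *v x)"
    by (simp add: Fz_def cpt_twist norm_mult)
  moreover have "rho (twist \<alpha> \<theta> \<Phi>) x = rho \<Phi> (rotation \<theta> *v x)"
    by (simp add: rho_def cpt_twist norm_mult)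
  ultimately show ?thesis
    by (simp only: spin_density_def norm_spin_vector_squared)
qed

text \<open>
  The transformation of the densities that contain derivatives, at a point \<open>x\<close> where the weak
  derivatives obey the chain rule. Almost every point has this property.
\<close>

context
  fixes \<alpha> \<theta> :: real and \<Phi> :: "'n::{finite,numeral} spinor" and x :: "'n space"
  assumes neq: "(1::'n) \<noteq> 2"
    and deriv: "\<And>l i. weak_partial i (cpt (twist \<alpha> \<theta> \<Phi>) l) x =
      spin_phase \<alpha> l *
        (\<Sum>j\<in>UNIV. of_real (rotation \<theta> $ j $ i) * weak_partial j (cpt \<Phi> l) (rotation \<theta> *v x))"
begin

lemma kin_density_twist: "kin_density (twist \<alpha> \<theta> \<Phi>) x = kin_density \<Phi> (rotation \<theta> *v x)"
proof -
  let ?w = "\<lambda>l i. weak_partial i (cpt \<Phi> l) (rotation \<theta> *v x)"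
  have "(\<Sum>i\<in>UNIV. (cmod (weak_partial i (cpt (twist \<alpha> \<theta> \<Phi>) l) x))\<^sup>2) = (\<Sum>i\<in>UNIV. (cmod (?w l i))\<^sup>2)" for l
  proof -
    have "(\<Sum>i\<in>- {1, 2}. (cmod (weak_partial i (cpt (twist \<alpha> \<theta> \<Phi>) l) x))\<^sup>2)
        = (\<Sum>i\<in>- {1, 2}. (cmod (?w l i))\<^sup>2)"
      by (intro sum.cong) (auto simp: deriv norm_mult sum_rotation_column[OF neq])
    moreover have "(cmod (of_real p * a + of_real q * b))\<^sup>2 + (cmod (- of_real q * a + of_real p * b))\<^sup>2
        = (q\<^sup>2 + p\<^sup>2) * ((cmod a)\<^sup>2 + (cmod b)\<^sup>2)" for p q a b
      unfolding cmod_power2 by (simp add: algebra_simps power2_eq_square)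
    note this[of "cos \<theta>" _ "sin \<theta>"]
    ultimately show ?thesis
      using neq by (simp add: sum_UNIV_12 deriv norm_mult sum_rotation_column[OF neq])
  qed
  then show ?thesis
    by (simp add: kin_density_def)
qed

lemma weak_partial_12_twist:
  "weak_partial 1 (cpt (twist \<alpha> \<theta> \<Phi>) l) x = spin_phase \<alpha> l *
    (of_real (cos \<theta>) * weak_partial 1 (cpt \<Phi> l) (rotation \<theta> *v x)
      + of_real (sin \<theta>) * weak_partial 2 (cpt \<Phi> l) (rotation \<theta> *v x))"
  "weak_partial 2 (cpt (twist \<alpha> \<theta> \<Phi>) l) x = spin_phase \<alpha> l *
    (- of_real (sin \<theta>) * weak_partial 1 (cpt \<Phi> l) (rotation \<theta> *v x)
      + of_real (cos \<theta>) * weak_partial 2 (cpt \<Phi> l) (rotation \<theta> *v x))"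
  using neq by (simp_all add: deriv sum_rotation_column[OF neq])

lemma rot_density_twist: "rot_density (twist \<alpha> \<theta> \<Phi>) x = rot_density \<Phi> (rotation \<theta> *v x)"
proof -
  have Lz: "Lz (cpt (twist \<alpha> \<theta> \<Phi>) l) x = spin_phase \<alpha> l * Lz (cpt \<Phi> l) (rotation \<theta> *v x)" for l
    using neq
    by (simp add: Lz_def weak_partial_12_twist rotation_mult_component[OF neq] algebra_simps)
  have "cnj (spin_phase \<alpha> l) * spin_phase \<alpha> l = 1" for l
    by (simp add: spin_phase_def cis_cnj cis_mult)
  then have "cnj (spin_phase \<alpha> l * a) * (spin_phase \<alpha> l * b) = cnj a * b" for l a b
    using arg_cong[of "cnj (spin_phase \<alpha> l) * spin_phase \<alpha> l" 1 "\<lambda>u. u * (cnj a * b)"]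
    by (simp add: mult_ac)
  then show ?thesis
    by (simp only: rot_density_def cpt_twist[THEN fun_cong] Lz)
qed

lemma L0_twist: "L0 (cpt (twist \<alpha> \<theta> \<Phi>) l) x
    = cis \<theta> * (spin_phase \<alpha> l * L0 (cpt \<Phi> l) (rotation \<theta> *v x))"
proof -
  have "\<i> * (u * (of_real (cos \<theta>) * a + of_real (sin \<theta>) * b))
      + u * (- of_real (sin \<theta>) * a + of_real (cos \<theta>) * b) = cis \<theta> * (u * (\<i> * a + b))" for u a b
    unfolding cis_conv_exp exp_Euler by (simp add: cos_of_real sin_of_real algebra_simps)
  then show ?thesis
    by (simp only: L0_def weak_partial_12_twist)
qed

lemma L1_twist: "L1 (cpt (twist \<alpha> \<theta> \<Phi>) l) x
    = cis (- \<theta>) * (spin_phase \<alpha> l * L1 (cpt \<Phi> l) (rotation \<theta> *v x))"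
proof -
  have "\<i> * (u * (of_real (cos \<theta>) * a + of_real (sin \<theta>) * b))
      - u * (- of_real (sin \<theta>) * a + of_real (cos \<theta>) * b) = cis (- \<theta>) * (u * (\<i> * a - b))" for u a b
    unfolding cis_conv_exp exp_Euler by (simp add: cos_of_real sin_of_real algebra_simps)
  then show ?thesis
    by (simp only: L1_def weak_partial_12_twist)
qed

lemma soc_up_twist: "soc_up (twist \<alpha> \<theta> \<Phi>) x = cis (\<theta> - \<alpha>) * soc_up \<Phi> (rotation \<theta> *v x)"
proof -
  have "cis (\<theta> - \<alpha>) = cis \<theta> * cis (- \<alpha>)"
    by (simp add: cis_mult)
  then show ?thesis
    by (simp add: soc_up_def L0_twist) (simp add: cpt_twist cis_cnj algebra_simps)
qed

lemma soc_down_twist: "soc_down (twist \<alpha> \<theta> \<Phi>) x = cis (\<alpha> - \<theta>) * soc_down \<Phi> (rotation \<theta> *v x)"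
proof -
  have "cis (\<alpha> - \<theta>) = cis (- \<theta>) * cis \<alpha>"
    by (simp add: cis_mult)
  then show ?thesis
    by (simp add: soc_down_def L1_twist) (simp add: cpt_twist cis_cnj algebra_simps)
qed

end

subsection \<open>Transformation of the energy\<close>

lemma soc_integrable:
  assumes "\<Phi> \<in> admissible V c0 c1"
  shows "integrable lebesgue (soc_up \<Phi>)" "integrable lebesgue (soc_down \<Phi>)"
proof -
  have H1: "cpt \<Phi> l \<in> H1" for l
    using assms UNIV_spin by (auto simp: admissible_def)
  then have "cpt \<Phi> l \<in> L2" for l
    by (simp add: H1_def)
  then have c: "(\<lambda>x. cnj (cpt \<Phi> l x)) \<in> L2" for l
    by (rule L2_cnj)
  have L0: "L0 (cpt \<Phi> l) \<in> L2" and L1: "L1 (cpt \<Phi> l) \<in> L2" for l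
    unfolding L0_def[abs_def] L1_def[abs_def]
    by (intro L2_add L2_diff L2_cmult weak_partial_H1 H1)+
  show "integrable lebesgue (soc_up \<Phi>)" "integrable lebesgue (soc_down \<Phi>)"
    unfolding soc_up_def[abs_def] soc_down_def[abs_def]
    by (intro Bochner_Integration.integrable_add L2_mult_integrable c L0 L1)+
qed

lemma E_soc_eq:
  assumes "\<Phi> \<in> admissible V c0 c1"
  shows "E_soc \<gamma> \<Phi> = - \<gamma> * Re (soc_amplitude \<Phi>)"
  using soc_integrable[OF assms]
  by (simp add: E_soc_def soc_density_eq soc_amplitude_def)

lemma
  fixes \<Phi> :: "'n::{finite,numeral} spinor"
  assumes neq: "(1::'n) \<noteq> 2" and V: "radially_symmetric V"
    and \<Phi>: "\<Phi> \<in> admissible V c0 c1"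
  shows twist_admissible: "twist \<alpha> \<theta> \<Phi> \<in> admissible V c0 c1"
    and soc_amplitude_twist: "soc_amplitude (twist \<alpha> \<theta> \<Phi>) = cis (\<theta> - \<alpha>) * soc_amplitude \<Phi>"
    and energy_twist: "energy V c0 c1 \<Omega> \<gamma> (twist \<alpha> \<theta> \<Phi>) - E_soc \<gamma> (twist \<alpha> \<theta> \<Phi>)
      = energy V c0 c1 \<Omega> \<gamma> \<Phi> - E_soc \<gamma> \<Phi>"
proof -
  let ?R = "\<lambda>x :: 'n space. rotation \<theta> *v x" and ?\<Psi> = "twist \<alpha> \<theta> \<Phi>"
  note R = orthogonal_transformation_rotation[OF neq, of \<theta>]
  have H1: "cpt \<Phi> l \<in> H1" for l
    using \<Phi> UNIV_spin by (auto simp: admissible_def)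
  have L2: "cpt \<Phi> l \<in> L2" for l
    using H1 by (simp add: H1_def)
  have fin: "finite_energy V c0 c1 \<Phi>"
    using \<Phi> by (simp add: admissible_def)
  have "AE x in lebesgue. \<forall>l i. weak_partial i (cpt ?\<Psi> l) x = spin_phase \<alpha> l *
      (\<Sum>j\<in>UNIV. of_real (rotation \<theta> $ j $ i) * weak_partial j (cpt \<Phi> l) (?R x))"
    unfolding cpt_twist
    by (intro eventually_all_finite AE_weak_partial_cmult_orthogonal R H1)
  then have AE: "AE x in lebesgue. kin_density ?\<Psi> x = kin_density \<Phi> (?R x)
      \<and> rot_density ?\<Psi> x = rot_density \<Phi> (?R x)
      \<and> soc_up ?\<Psi> x = cis (\<theta> - \<alpha>) * soc_up \<Phi> (?R x)
      \<and> soc_down ?\<Psi> x = cis (\<alpha> - \<theta>) * soc_down \<Phi> (?R x)"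
    by eventually_elim
      (intro conjI kin_density_twist rot_density_twist soc_up_twist soc_down_twist neq; blast)
  have kin: "integrable lebesgue (kin_density ?\<Psi>)"
      "(LINT x|lebesgue. kin_density ?\<Psi> x) = (LINT x|lebesgue. kin_density \<Phi> x)"
    using AE fin integrable_integral_AE_orthogonal[OF R, of "kin_density \<Phi>" "kin_density ?\<Psi>"]
    by (auto simp: finite_energy_def)
  have rot: "integrable lebesgue (rot_density ?\<Psi>)"
      "(LINT x|lebesgue. rot_density ?\<Psi> x) = (LINT x|lebesgue. rot_density \<Phi> x)"
    using AE fin integrable_integral_AE_orthogonal[OF R, of "rot_density \<Phi>" "rot_density ?\<Psi>"]
    by (auto simp: finite_energy_def)
  have up: "integrable lebesgue (soc_up ?\<Psi>)"
      "(LINT x|lebesgue. soc_up ?\<Psi> x) = cis (\<theta> - \<alpha>) * (LINT x|lebesgue. soc_up \<Phi> x)"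
    using AE soc_integrable[OF \<Phi>]
      integrable_integral_AE_orthogonal[OF R, of "\<lambda>x. cis (\<theta> - \<alpha>) * soc_up \<Phi> x" "soc_up ?\<Psi>"]
    by auto
  have down: "integrable lebesgue (soc_down ?\<Psi>)"
      "(LINT x|lebesgue. soc_down ?\<Psi> x) = cis (\<alpha> - \<theta>) * (LINT x|lebesgue. soc_down \<Phi> x)"
    using AE soc_integrable[OF \<Phi>]
      integrable_integral_AE_orthogonal[OF R, of "\<lambda>x. cis (\<alpha> - \<theta>) * soc_down \<Phi> x" "soc_down ?\<Psi>"]
    by auto
  have pot: "integrable lebesgue (pot_density V ?\<Psi>)"
      "(LINT x|lebesgue. pot_density V ?\<Psi> x) = (LINT x|lebesgue. pot_density V \<Phi> x)"
    using fin integrable_integral_AE_orthogonal[OF R, of "pot_density V \<Phi>" "pot_density V ?\<Psi>"]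
      pot_density_twist[OF neq V]
    by (auto simp: finite_energy_def)
  have spin: "integrable lebesgue (spin_density c0 c1 ?\<Psi>)"
      "(LINT x|lebesgue. spin_density c0 c1 ?\<Psi> x) = (LINT x|lebesgue. spin_density c0 c1 \<Phi> x)"
    using fin integrable_integral_AE_orthogonal[OF R, of "spin_density c0 c1 \<Phi>" "spin_density c0 c1 ?\<Psi>"]
      spin_density_twist[of c0 c1 \<alpha> \<theta> \<Phi>]
    by (simp_all add: finite_energy_def)
  have finite: "finite_energy V c0 c1 ?\<Psi>"
    using kin(1) pot(1) spin(1) rot(1) up(1) down(1)
    by (simp add: finite_energy_def soc_density_eq[abs_def])
  have "integrable lebesgue (\<lambda>x. \<Sum>l\<in>{-1, 0, 1}. (cmod (cpt \<Phi> l x))\<^sup>2)"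
    using L2 by (simp add: L2_def)
  then have mass: "(LINT x|lebesgue. (\<Sum>l\<in>{-1, 0, 1}. (cmod (cpt ?\<Psi> l x))\<^sup>2)) = 1"
    using \<Phi> by (subst integrable_integral_AE_orthogonal(2)[OF R])
      (auto simp: admissible_def cpt_twist norm_mult)
  have "cpt ?\<Psi> l \<in> H1" for l
    unfolding cpt_twist by (rule H1_cmult_orthogonal[OF R H1])
  moreover have "cpt ?\<Psi> l \<in> L2_weighted V" for l
  proof -
    have VR: "V (?R x) = V x" for x
      using V orthogonal_transformation_norm[OF R] unfolding radially_symmetric_def by metis
    have "integrable lebesgue (\<lambda>x. V x * (cmod (cpt \<Phi> l x))\<^sup>2)"
      using \<Phi> UNIV_spin by (auto simp: admissible_def L2_weighted_def)
    then have "integrable lebesgue (\<lambda>x. V (?R x) * (cmod (cpt \<Phi> l (?R x)))\<^sup>2)"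
      by (rule integrable_orthogonal[OF R])
    then show ?thesis
      by (simp add: L2_weighted_def cpt_twist norm_mult VR)
  qed
  ultimately show "?\<Psi> \<in> admissible V c0 c1"
    using mass finite by (simp add: admissible_def)
  have "cis (\<theta> - \<alpha>) = cnj (cis (\<alpha> - \<theta>))"
    by (simp add: cis_cnj)
  with up(2) down(2) show "soc_amplitude ?\<Psi> = cis (\<theta> - \<alpha>) * soc_amplitude \<Phi>"
    by (simp add: soc_amplitude_def distrib_left)
  show "energy V c0 c1 \<Omega> \<gamma> ?\<Psi> - E_soc \<gamma> ?\<Psi> = energy V c0 c1 \<Omega> \<gamma> \<Phi> - E_soc \<gamma> \<Phi>"
    using kin(2) pot(2) spin(2) rot(2)
    by (simp add: energy_def E_kin_def E_pot_def E_spin_def E_rot_def)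
qed

text \<open>
  Comparison of a ground state with its pure spin rotations.
\<close>

lemma ground_state_soc_amplitude:
  fixes \<Phi> :: "'n::{finite,numeral} spinor"
  assumes neq: "(1::'n) \<noteq> 2" and V: "radially_symmetric V"
    and gs: "ground_state V c0 c1 \<Omega> \<gamma> \<Phi>"
  shows "\<gamma> * soc_amplitude \<Phi> = of_real (- E_soc \<gamma> \<Phi>)" and "E_soc \<gamma> \<Phi> \<le> 0"
proof -
  have \<Phi>: "\<Phi> \<in> admissible V c0 c1"
    using gs by (simp add: ground_state_def)
  define z where "z = \<gamma> * soc_amplitude \<Phi>"
  have E: "E_soc \<gamma> \<Phi> = - Re z"
    using E_soc_eq[OF \<Phi>] by (simp add: z_def)
  have le: "Re (cis \<beta> * z) \<le> Re z" for \<beta>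
  proof -
    let ?\<Psi> = "twist (- \<beta>) 0 \<Phi>"
    have \<Psi>: "?\<Psi> \<in> admissible V c0 c1"
      by (rule twist_admissible[OF neq V \<Phi>])
    then have "energy V c0 c1 \<Omega> \<gamma> \<Phi> \<le> energy V c0 c1 \<Omega> \<gamma> ?\<Psi>"
      using gs by (simp add: ground_state_def)
    then have "E_soc \<gamma> \<Phi> \<le> E_soc \<gamma> ?\<Psi>"
      using energy_twist[OF neq V \<Phi>, of \<Omega> \<gamma> "- \<beta>" 0] by simp
    moreover have "E_soc \<gamma> ?\<Psi> = - Re (cis \<beta> * z)"
      using E_soc_eq[OF \<Psi>] soc_amplitude_twist[OF neq V \<Phi>, of "- \<beta>" 0]
      by (simp add: z_def algebra_simps)
    ultimately show ?thesis
      using E by simp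
  qed
  \<comment> \<open>The best choice of \<open>\<beta>\<close> turns \<open>z\<close> onto the positive real axis.\<close>
  have "cis (- Arg z) * z = cmod z"
    using rcis_cmod_Arg[of z] by (metis cis_mult cis_zero ab_left_minus mult.left_commute mult.right_neutral rcis_def)
  with le[of "- Arg z"] have "cmod z \<le> Re z"
    by simp
  then have "z = of_real (Re z)" "0 \<le> Re z"
    using complex_Re_le_cmod[of z] norm_ge_zero[of z] cmod_power2[of z]
    by (auto simp: complex_eq_iff)
  then show "\<gamma> * soc_amplitude \<Phi> = of_real (- E_soc \<gamma> \<Phi>)" "E_soc \<gamma> \<Phi> \<le> 0"
    using E by (simp_all add: z_def)
qed

theorem theorem3:
  fixes V :: "'n::{finite,comm_ring_1} space \<Rightarrow> real"
    and c0 c1 \<Omega> \<gamma> :: real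
    and \<Phi>g :: "'n spinor"
  assumes "CARD('n) \<in> {2, 3}"
    and "radially_symmetric V"
    and "ground_state V c0 c1 \<Omega> \<gamma> \<Phi>g"
  shows "E_soc \<gamma> \<Phi>g \<le> 0 \<and>
    (E_soc \<gamma> \<Phi>g = 0 \<longrightarrow>
       (\<forall>\<theta>\<in>{0<..<2 * pi}. ground_state V c0 c1 \<Omega> \<gamma> (\<lambda>x. \<Phi>g (rotation \<theta> *v x)))) \<and>
    (E_soc \<gamma> \<Phi>g < 0 \<longrightarrow>
       (\<forall>\<theta>\<in>{0<..<2 * pi}. \<not> ground_state V c0 c1 \<Omega> \<gamma> (\<lambda>x. \<Phi>g (rotation \<theta> *v x))))"
proof -
  \<comment> \<open>In a ring with \<open>1 \<noteq> 0\<close> also \<open>2 = 1 + 1 \<noteq> 1\<close>.\<close>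
  have neq: "(1::'n) \<noteq> 2"
    by (metis add_cancel_right_left one_add_one zero_neq_one)
  note V = assms(2) and gs = assms(3)
  have \<Phi>g: "\<Phi>g \<in> admissible V c0 c1"
    using gs by (simp add: ground_state_def)
  have E: "energy V c0 c1 \<Omega> \<gamma> (twist 0 \<theta> \<Phi>g)
      = energy V c0 c1 \<Omega> \<gamma> \<Phi>g + (cos \<theta> - 1) * E_soc \<gamma> \<Phi>g" for \<theta>
  proof -
    have "E_soc \<gamma> (twist 0 \<theta> \<Phi>g) = - Re (cis \<theta> * (\<gamma> * soc_amplitude \<Phi>g))"
      using E_soc_eq[OF twist_admissible[OF neq V \<Phi>g, of 0 \<theta>]] soc_amplitude_twist[OF neq V \<Phi>g, of 0 \<theta>]
      by (simp add: algebra_simps)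
    also have "\<dots> = cos \<theta> * E_soc \<gamma> \<Phi>g"
      by (simp add: ground_state_soc_amplitude(1)[OF neq V gs])
    finally show ?thesis
      using energy_twist[OF neq V \<Phi>g, of \<Omega> \<gamma> 0 \<theta>] by (simp add: algebra_simps)
  qed
  have ground_iff: "ground_state V c0 c1 \<Omega> \<gamma> (twist 0 \<theta> \<Phi>g) \<longleftrightarrow>
      energy V c0 c1 \<Omega> \<gamma> (twist 0 \<theta> \<Phi>g) \<le> energy V c0 c1 \<Omega> \<gamma> \<Phi>g" for \<theta>
    using gs twist_admissible[OF neq V \<Phi>g, of 0 \<theta>] \<Phi>g
    unfolding ground_state_def by (meson order_trans)
  have cos_less: "cos \<theta> < 1" if "\<theta> \<in> {0<..<2 * pi}" for \<theta>
  proof -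
    have "cos \<theta> \<noteq> 1"
    proof
      assume "cos \<theta> = 1"
      then obtain n :: int where n: "\<theta> = of_int n * (2 * pi)"
        by (auto simp: cos_one_2pi_int)
      with that have "0 < real_of_int n" "real_of_int n < 1"
        by (auto simp: zero_less_mult_iff)
      then show False
        by simp
    qed
    then show ?thesis
      using cos_le_one[of \<theta>] by linarith
  qed
  have "\<not> ground_state V c0 c1 \<Omega> \<gamma> (twist 0 \<theta> \<Phi>g)" if "E_soc \<gamma> \<Phi>g < 0" "\<theta> \<in> {0<..<2 * pi}" for \<theta>
    unfolding ground_iff E using mult_neg_neg[of "cos \<theta> - 1" "E_soc \<gamma> \<Phi>g"] that cos_less[of \<theta>]
    by simp
  then show ?thesis
    unfolding twist_0[symmetric] using ground_state_soc_amplitude(2)[OF neq V gs]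
    by (simp add: ground_iff E)
qed

end
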